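(* Let $m$ be a fixed constant and $\epsilon>0$ fixed. Consider the knapsack center problem with $m$ knapsack constraints: given a finite metric space $(V,d)$, nonnegative weight functions $w_1,\dots,w_m$ on $V$ and budgets $L_1,\dots,L_m$, find $\mathcal{S}\subseteq V$ with $w_i(\mathcal{S})=\sum_{v\in\mathcal{S}}w_i(v)\le L_i$ for all $1\le i\le m$ minimizing $\max_{v\in V}\min_{u\in\mathcal{S}}d(v,u)$; let $\mathrm{OPT}$ be the optimum (assuming a feasible solution exists). There is a polynomial-time algorithm that returns a set $\mathcal{S}\subseteq V$ with $\max_{v\in V}\min_{u\in\mathcal{S}}d(v,u)\le 3\,\mathrm{OPT}$ which satisfies one of the knapsack constraints and satisfies each of the others up to a factor $1+\epsilon$, i.e., $w_i(\mathcal{S})\le(1+\epsilon)L_i$. *)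

theory Defs
  imports "HOL-Analysis.Analysis" "HOL-Computational_Algebra.Polynomial" "HOL-Library.Log_Nat"
begin

text \<open>
  Polynomial time is measured on a random access machine over the rationals with logarithmic cost:
  every operation is charged the binary encoding length of the numbers (operands, results and
  addresses) involved. Since each primitive operation on rationals is computable in time polynomial
  in these lengths, this is the usual notion up to polynomial factors. Programs are structured
  rather than given by jumps, and the memory is split into arrays whose names are constants of the
  program.
\<close>

definition rat_size :: "rat \<Rightarrow> nat" where
  "rat_size r = (case quotient_of r of (p, q) \<Rightarrow>
     1 + floorlog 2 (nat \<bar>p\<bar>) + floorlog 2 (nat q))"

type_synonym state = "nat \<Rightarrow> nat \<Rightarrow> rat"

datatype aexp =
    Const rat
  | Read nat aexp
  | Add aexp aexp
  | Sub aexp aexp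
  | Mul aexp aexp
  | Div aexp aexp

text \<open>Addresses are rounded to natural numbers, so that every expression has a value.\<close>

definition address :: "rat \<Rightarrow> nat" where
  "address r = nat \<lfloor>r\<rfloor>"

fun aval :: "aexp \<Rightarrow> state \<Rightarrow> rat" where
  "aval (Const r) s = r"
| "aval (Read a e) s = s a (address (aval e s))"
| "aval (Add e e') s = aval e s + aval e' s"
| "aval (Sub e e') s = aval e s - aval e' s"
| "aval (Mul e e') s = aval e s * aval e' s"
| "aval (Div e e') s = aval e s / aval e' s"

fun acost :: "aexp \<Rightarrow> state \<Rightarrow> nat" where
  "acost (Const r) s = rat_size r"
| "acost (Read a e) s = acost e s + rat_size (aval (Read a e) s)"
| "acost (Add e e') s = acost e s + acost e' s + rat_size (aval (Add e e') s)"
| "acost (Sub e e') s = acost e s + acost e' s + rat_size (aval (Sub e e') s)"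
| "acost (Mul e e') s = acost e s + acost e' s + rat_size (aval (Mul e e') s)"
| "acost (Div e e') s = acost e s + acost e' s + rat_size (aval (Div e e') s)"

datatype bexp =
    Leq aexp aexp
  | Neg bexp
  | Conj bexp bexp

fun bval :: "bexp \<Rightarrow> state \<Rightarrow> bool" where
  "bval (Leq e e') s \<longleftrightarrow> aval e s \<le> aval e' s"
| "bval (Neg b) s \<longleftrightarrow> \<not> bval b s"
| "bval (Conj b b') s \<longleftrightarrow> bval b s \<and> bval b' s"

fun bcost :: "bexp \<Rightarrow> state \<Rightarrow> nat" where
  "bcost (Leq e e') s = 1 + acost e s + acost e' s"
| "bcost (Neg b) s = 1 + bcost b s"
| "bcost (Conj b b') s = 1 + bcost b s + bcost b' s"

datatype com =
    Skip
  | Assign nat aexp aexp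
  | Seq com com
  | Cond bexp com com
  | While bexp com

text \<open>\<open>exec c s t s'\<close>: started in \<open>s\<close>, program \<open>c\<close> halts in \<open>s'\<close> at total cost \<open>t\<close>.
  The command \<open>Assign a i e\<close> writes the value of \<open>e\<close> to position \<open>i\<close> of array \<open>a\<close>.\<close>

inductive exec :: "com \<Rightarrow> state \<Rightarrow> nat \<Rightarrow> state \<Rightarrow> bool" where
  Skip: "exec Skip s 1 s"
| Assign: "exec (Assign a i e) s (1 + acost i s + acost e s)
             (s(a := (s a)(address (aval i s) := aval e s)))"
| Seq: "exec c s t s' \<Longrightarrow> exec c' s' t' s'' \<Longrightarrow> exec (Seq c c') s (t + t') s''"
| CondTrue: "bval b s \<Longrightarrow> exec c s t s' \<Longrightarrow> exec (Cond b c c') s (bcost b s + t) s'"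
| CondFalse: "\<not> bval b s \<Longrightarrow> exec c' s t s' \<Longrightarrow> exec (Cond b c c') s (bcost b s + t) s'"
| WhileFalse: "\<not> bval b s \<Longrightarrow> exec (While b c) s (bcost b s) s"
| WhileTrue: "bval b s \<Longrightarrow> exec c s t s' \<Longrightarrow> exec (While b c) s' t' s'' \<Longrightarrow>
                exec (While b c) s (bcost b s + t + t') s''"

inductive_cases exec_elims:
  "exec Skip s t s'" "exec (Assign a i e) s t s'" "exec (Seq c c') s t s'"
  "exec (Cond b c c') s t s'" "exec (While b c) s t s'"

lemma exec_deterministic:
  assumes "exec c s t s'" "exec c s u s''"
  shows "u = t \<and> s'' = s'"
  using assms
proof (induction arbitrary: u s'' rule: exec.induct)
  case (Skip s)
  then show ?case by (auto elim: exec_elims(1))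
next
  case (Assign a i e s)
  then show ?case by (auto elim: exec_elims(2))
next
  case (Seq c s t s' c' t' s2)
  from Seq.prems show ?case by (rule exec_elims(3)) (use Seq.IH in blast)
next
  case (CondTrue b s c t s' c')
  from CondTrue.prems show ?case
    by (rule exec_elims(4)) (use CondTrue.hyps CondTrue.IH in blast)+
next
  case (CondFalse b s c' t s' c)
  from CondFalse.prems show ?case
    by (rule exec_elims(4)) (use CondFalse.hyps CondFalse.IH in blast)+
next
  case (WhileFalse b s c)
  from WhileFalse.prems show ?case
    by (rule exec_elims(5)) (use WhileFalse.hyps in blast)+
next
  case (WhileTrue b s c t s' t' s2)
  from WhileTrue.prems show ?case
    by (rule exec_elims(5)) (use WhileTrue.hyps WhileTrue.IH in blast)+
qed

text \<open>The input is stored in array 0; all other memory cells are initially 0.\<close>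

definition init_state :: "rat list \<Rightarrow> state" where
  "init_state xs = (\<lambda>a i. if a = 0 \<and> i < length xs then xs ! i else 0)"

definition input_size :: "rat list \<Rightarrow> nat" where
  "input_size xs = (\<Sum>x\<leftarrow>xs. rat_size x)"

definition polynomial_time_on :: "com \<Rightarrow> rat list set \<Rightarrow> bool" where
  "polynomial_time_on c I \<longleftrightarrow> (\<exists>p :: nat poly. \<forall>xs\<in>I. \<exists>t s.
     exec c (init_state xs) t s \<and> t \<le> poly p (input_size xs))"

text \<open>Instances have point set \<open>{..<n}\<close>; the \<open>m\<close> constraints are indexed by \<open>{1..m}\<close>.\<close>

definition knapsack_instance ::
    "nat \<Rightarrow> nat \<Rightarrow> (nat \<Rightarrow> nat \<Rightarrow> rat) \<Rightarrow> (nat \<Rightarrow> nat \<Rightarrow> rat) \<Rightarrow> bool" where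
  "knapsack_instance m n d w \<longleftrightarrow>
     Metric_space {..<n} (\<lambda>u v. real_of_rat (d u v)) \<and>
     (\<forall>i\<in>{1..m}. \<forall>v<n. 0 \<le> w i v)"

definition encode ::
    "nat \<Rightarrow> nat \<Rightarrow> (nat \<Rightarrow> nat \<Rightarrow> rat) \<Rightarrow> (nat \<Rightarrow> nat \<Rightarrow> rat) \<Rightarrow> (nat \<Rightarrow> rat) \<Rightarrow> rat list" where
  "encode m n d w L = of_nat n
     # concat (map (\<lambda>u. map (\<lambda>v. d u v) [0..<n]) [0..<n])
     @ concat (map (\<lambda>i. map (\<lambda>v. w i v) [0..<n]) [1..<Suc m])
     @ map L [1..<Suc m]"

definition feasible ::
    "nat \<Rightarrow> nat \<Rightarrow> (nat \<Rightarrow> nat \<Rightarrow> rat) \<Rightarrow> (nat \<Rightarrow> rat) \<Rightarrow> nat set \<Rightarrow> bool" where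
  "feasible m n w L S \<longleftrightarrow> S \<subseteq> {..<n} \<and> (\<forall>i\<in>{1..m}. (\<Sum>v\<in>S. w i v) \<le> L i)"

text \<open>With values in \<^typ>\<open>ennreal\<close>, the empty set of centers has radius \<open>\<infinity>\<close> unless \<open>n = 0\<close>. For
  nonempty finite sets the supremum and infima are a maximum and minima.\<close>

definition radius :: "nat \<Rightarrow> (nat \<Rightarrow> nat \<Rightarrow> rat) \<Rightarrow> nat set \<Rightarrow> ennreal" where
  "radius n d S = (SUP v\<in>{..<n}. INF u\<in>S. ennreal (real_of_rat (d v u)))"

definition OPT ::
    "nat \<Rightarrow> nat \<Rightarrow> (nat \<Rightarrow> nat \<Rightarrow> rat) \<Rightarrow> (nat \<Rightarrow> nat \<Rightarrow> rat) \<Rightarrow> (nat \<Rightarrow> rat) \<Rightarrow> ennreal" where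
  "OPT m n d w L = (INF S\<in>{S. feasible m n w L S}. radius n d S)"

text \<open>A set of points is returned as its characteristic vector in array 1.\<close>

definition returned_set :: "nat \<Rightarrow> state \<Rightarrow> nat set" where
  "returned_set n s = {v. v < n \<and> s 1 v = 1}"

end

theory Submission imports Defs begin

text \<open>
  Try every entry \<open>r\<close> of the distance matrix as radius. Greedily select pivots at pairwise distance
  more than \<open>2 r\<close>; every point is within \<open>2 r\<close> of a pivot and the balls of radius \<open>r\<close> around the
  pivots are disjoint. A feasible solution of radius at most \<open>r\<close> has a center in each ball, and
  conversely any choice of one point from each ball has radius at most \<open>3 r\<close>. So it remains to
  choose one point per ball subject to the knapsack constraints. For this, the weight of \<open>v\<close> in
  constraint \<open>j\<close> is rounded to the digit \<open>\<lfloor>w j v * K / L j\<rfloor>\<close> with \<open>K = N * n\<close> and \<open>1 / N < \<epsilon>\<close>, and a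
  dynamic program computes, for every vector of digit sums, a choice of minimal weight in the first
  constraint. A choice with the same digit sums as a feasible one exceeds each budget by a factor of
  at most \<open>1 + n / K\<close>. The vectors of digit sums are encoded as numbers in a base that
  excludes carries, so that for fixed \<open>m\<close> the table has polynomial size.

  The running time is bounded simultaneously with correctness: if all loops make at most \<open>B\<close>
  iterations and all stored numbers have size at most \<open>B\<close>, then the cost of a program is at most a
  polynomial in \<open>B\<close> which depends only on its syntax.
\<close>

section \<open>Size of rationals\<close>

text \<open>One constraint holds exactly because the table minimises in it: among all choices with
  the digit sums of a feasible choice, the stored one is no heavier there. The other constraints pay
  only for rounding. The table works with sums alone, for two reasons. Disjoint balls mean that a
  newly chosen point is never already in the set, so that codes and weights add. And a point heavier
  than some budget cannot occur in a feasible set; excluding such points in advance bounds every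
  digit by \<open>K\<close>. A radius below the optimum may admit no feasible set, yet its table may
  contain choices. The true weights of a candidate are therefore tested before it is stored, so that
  a stored result always respects the relaxed budgets. The optimum is itself an entry of the
  distance matrix, hence it suffices that the stored radius ends up at most every entry for which a
  feasible set exists. Stored numbers stay short: they are counters, input values, codes, sums of
  weights and masks of at most n bits or powers of two up to 2 ^ n.\<close>

definition height :: "rat \<Rightarrow> nat" where
  "height r = (case quotient_of r of (p, q) \<Rightarrow> nat \<bar>p\<bar> + nat q)"

text \<open>\<open>height\<close> is submultiplicative under both sums and products, so its bit
  length is subadditive under all four operations. Up to a factor 2 and an additive 1 it agrees with
  \<open>rat_size\<close>.\<close>

definition log_height :: "rat \<Rightarrow> nat" where
  "log_height r = floorlog 2 (height r)"

lemma height_pos: "0 < height r"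
  using quotient_of_denom_pos[of r] by (auto simp: height_def split: prod.split)

text \<open>Reduction to lowest terms divides numerator and denominator by a common factor, so any
  unreduced representation gives an upper bound. The arithmetic lemmas thereby avoid all gcd
  computations.\<close>

lemma height_fract_le:
  assumes "q \<noteq> 0"
  shows "height (Fract p q) \<le> nat \<bar>p\<bar> + nat \<bar>q\<bar>"
proof -
  obtain a b where ab: "quotient_of (Fract p q) = (a, b)" by force
  then have b: "b > 0" and cop: "coprime a b"
    using quotient_of_denom_pos quotient_of_coprime by blast+
  have "Fract p q = Fract a b"
    using ab quotient_of_inject[of "Fract p q" "Fract a b"] by (metis quotient_of_div Fract_of_int_quotient)
  then have eq: "p * b = a * q" using assms b by (simp add: eq_rat)
  then have "b dvd a * q" by (metis dvd_triv_right)
  then have "b dvd q" using cop by (simp add: coprime_commute coprime_dvd_mult_right_iff)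
  then obtain k where k: "q = b * k" by blast
  then have p: "p = a * k" using eq b by (simp add: mult.assoc mult.left_commute)
  have "k \<noteq> 0" using k assms by auto
  then have "1 \<le> \<bar>k\<bar>" by linarith
  then have "\<bar>a\<bar> \<le> \<bar>p\<bar>" "b \<le> \<bar>q\<bar>"
    using b k p by (auto simp: abs_mult mult_le_cancel_left1)
  then show ?thesis using ab b by (simp add: height_def nat_mono add_mono)
qed

lemma fract_height_cases:
  obtains p q where "q > 0" "r = Fract p q" "height r = nat \<bar>p\<bar> + nat q"
proof -
  obtain p q where pq: "quotient_of r = (p, q)" by force
  have "q > 0" using quotient_of_denom_pos pq by blast
  moreover have "r = Fract p q" using pq quotient_of_div Fract_of_int_quotient by metis
  ultimately show thesis using that pq by (simp add: height_def)
qed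

lemma nat_abs_mult: "nat \<bar>a * b\<bar> = nat \<bar>a\<bar> * nat \<bar>b\<bar>"
  by (simp add: abs_mult nat_mult_distrib)

lemma height_mult: "height (a * b) \<le> height a * height b"
proof -
  obtain p q where a: "q > 0" "a = Fract p q" "height a = nat \<bar>p\<bar> + nat q" by (rule fract_height_cases)
  obtain p' q' where b: "q' > 0" "b = Fract p' q'" "height b = nat \<bar>p'\<bar> + nat q'"
    by (rule fract_height_cases)
  have "height (a * b) \<le> nat \<bar>p * p'\<bar> + nat \<bar>q * q'\<bar>"
    using height_fract_le[of "q * q'" "p * p'"] a b by simp
  also have "\<dots> \<le> height a * height b" using a b by (simp add: nat_abs_mult nat_mult_distrib algebra_simps)
  finally show ?thesis .
qed

text \<open>Expanding the product of the two heights yields |p| q', |p'| q and q q', which bound the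
  unreduced sum, plus the nonnegative term |p| |p'|.\<close>

lemma height_add: "height (a + b) \<le> height a * height b"
proof -
  obtain p q where a: "q > 0" "a = Fract p q" "height a = nat \<bar>p\<bar> + nat q" by (rule fract_height_cases)
  obtain p' q' where b: "q' > 0" "b = Fract p' q'" "height b = nat \<bar>p'\<bar> + nat q'"
    by (rule fract_height_cases)
  have "height (a + b) \<le> nat \<bar>p * q' + p' * q\<bar> + nat \<bar>q * q'\<bar>"
    using height_fract_le[of "q * q'" "p * q' + p' * q"] a b by simp
  also have "nat \<bar>p * q' + p' * q\<bar> \<le> nat \<bar>p * q'\<bar> + nat \<bar>p' * q\<bar>" by linarith
  also have "nat \<bar>p * q'\<bar> + nat \<bar>p' * q\<bar> + nat \<bar>q * q'\<bar> \<le> height a * height b"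
    using a b by (simp add: nat_abs_mult nat_mult_distrib algebra_simps)
  finally show ?thesis by simp
qed

lemma height_uminus: "height (- a) = height a"
  by (auto simp: height_def rat_uminus_code split: prod.split)

lemma height_inverse: "height (inverse a) \<le> height a"
proof -
  obtain p q where a: "q > 0" "a = Fract p q" "height a = nat \<bar>p\<bar> + nat q" by (rule fract_height_cases)
  show ?thesis
  proof (cases "p = 0")
    case True
    then show ?thesis using a by (simp add: rat_number_collapse)
  next
    case False
    then show ?thesis using height_fract_le[of p q] a by simp
  qed
qed

lemma floorlog_mult_le:
  assumes "0 < a" "0 < b"
  shows "floorlog 2 (a * b) \<le> floorlog 2 a + floorlog 2 b"
proof -
  have "a < 2 ^ floorlog 2 a" "b < 2 ^ floorlog 2 b" using floorlog_leD by auto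
  then have "a * b < 2 ^ (floorlog 2 a + floorlog 2 b)"
    by (simp add: power_add mult_strict_mono)
  then show ?thesis using floorlog_le_iff[of 2] by simp
qed

lemma floorlog_add_le: "floorlog 2 (a + b) \<le> 1 + floorlog 2 a + floorlog 2 b"
proof -
  have "a < 2 ^ floorlog 2 a" "b < 2 ^ floorlog 2 b" using floorlog_leD by auto
  moreover have "(2::nat) ^ floorlog 2 a \<le> 2 ^ (floorlog 2 a + floorlog 2 b)"
    "(2::nat) ^ floorlog 2 b \<le> 2 ^ (floorlog 2 a + floorlog 2 b)"
    by (auto intro: power_increasing)
  ultimately have "a + b < 2 ^ (floorlog 2 a + floorlog 2 b) + 2 ^ (floorlog 2 a + floorlog 2 b)"
    by (meson add_less_le_mono less_imp_le order_less_le_trans)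
  then have "a + b < 2 ^ (1 + floorlog 2 a + floorlog 2 b)" by simp
  then show ?thesis using floorlog_le_iff[of 2] by simp
qed

lemma log_height_le_of_height:
  "height c \<le> height a * height b \<Longrightarrow> log_height c \<le> log_height a + log_height b"
  unfolding log_height_def
  by (meson floorlog_mono floorlog_mult_le height_pos order_trans)

lemma log_height_mult: "log_height (a * b) \<le> log_height a + log_height b"
  by (intro log_height_le_of_height height_mult)

lemma log_height_add: "log_height (a + b) \<le> log_height a + log_height b"
  by (intro log_height_le_of_height height_add)

lemma log_height_diff: "log_height (a - b) \<le> log_height a + log_height b"
  using log_height_add[of a "- b"] by (simp add: log_height_def height_uminus)

lemma log_height_divide: "log_height (a / b) \<le> log_height a + log_height b"
proof -
  have "height (a / b) \<le> height a * height (inverse b)"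
    using height_mult[of a "inverse b"] by (simp add: divide_inverse)
  also have "\<dots> \<le> height a * height b" using height_inverse by simp
  finally show ?thesis by (rule log_height_le_of_height)
qed

text \<open>The 1 pays for the empty sum: 0 is the fraction 0 / 1, whose height has bit length
  1.\<close>

lemma log_height_sum: "log_height (\<Sum>v\<in>S. f v) \<le> 1 + (\<Sum>v\<in>S. log_height (f v))"
proof (induction S rule: infinite_finite_induct)
  case (insert x F)
  have "log_height (f x + sum f F) \<le> log_height (f x) + log_height (sum f F)" by (rule log_height_add)
  then show ?case using insert by simp
qed (simp_all add: log_height_def height_def floorlog_def)

lemma log_height_le_rat_size: "log_height r \<le> rat_size r"
  unfolding log_height_def height_def rat_size_def
  using floorlog_add_le by (auto split: prod.split)

lemma rat_size_le_log_height: "rat_size r \<le> 1 + 2 * log_height r"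
  unfolding log_height_def height_def rat_size_def
  by (auto split: prod.split simp: mult_2 intro!: add_mono floorlog_mono)

lemma rat_size_pos: "1 \<le> rat_size r"
  by (auto simp: rat_size_def split: prod.split)

lemma rat_size_of_nat: "rat_size (of_nat k) = 2 + floorlog 2 k"
proof -
  have "quotient_of (of_nat k) = (int k, 1)"
    using quotient_of_int[of "int k"] by (simp add: Rat.of_int_def)
  then show ?thesis by (simp add: rat_size_def floorlog_def)
qed

lemma rat_size_of_nat_less_power: "k < 2 ^ n \<Longrightarrow> rat_size (of_nat k) \<le> n + 2"
  using floorlog_le_iff[of 2 k n] by (simp add: rat_size_of_nat)

lemma rat_size_of_nat_le: "rat_size (of_nat k) \<le> k + 2"
  using rat_size_of_nat_less_power[OF less_exp] .

section \<open>A weakest precondition calculus with polynomial time bounds\<close>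

text \<open>Coefficient of B in the bit length of a value: a cell read contributes at most B, a
  constant its own size, and operations add these contributions.\<close>

fun leaves :: "aexp \<Rightarrow> nat" where
  "leaves (Const r) = rat_size r"
| "leaves (Read a e) = 1"
| "leaves (Add e e') = leaves e + leaves e'"
| "leaves (Sub e e') = leaves e + leaves e'"
| "leaves (Mul e e') = leaves e + leaves e'"
| "leaves (Div e e') = leaves e + leaves e'"

text \<open>At an operation, \<open>1 + 2 * leaves\<close> pays for the size of the result, by way
  of \<open>rat_size r \<le> 1 + 2 * log_height r\<close>.\<close>

fun acoeff :: "aexp \<Rightarrow> nat" where
  "acoeff (Const r) = rat_size r"
| "acoeff (Read a e) = acoeff e + 1"
| "acoeff (Add e e') = acoeff e + acoeff e' + 1 + 2 * (leaves e + leaves e')"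
| "acoeff (Sub e e') = acoeff e + acoeff e' + 1 + 2 * (leaves e + leaves e')"
| "acoeff (Mul e e') = acoeff e + acoeff e' + 1 + 2 * (leaves e + leaves e')"
| "acoeff (Div e e') = acoeff e + acoeff e' + 1 + 2 * (leaves e + leaves e')"

fun bcoeff :: "bexp \<Rightarrow> nat" where
  "bcoeff (Leq e e') = 1 + acoeff e + acoeff e'"
| "bcoeff (Neg b) = 1 + bcoeff b"
| "bcoeff (Conj b b') = 1 + bcoeff b + bcoeff b'"

text \<open>\<open>1 \<le> B\<close> lets additive constants be absorbed into multiples of
  B.\<close>

definition bounded_state :: "nat \<Rightarrow> state \<Rightarrow> bool" where
  "bounded_state B s \<longleftrightarrow> 1 \<le> B \<and> (\<forall>a i. rat_size (s a i) \<le> B)"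

text \<open>Bounds the cost of a program all of whose loops make at most \<open>B\<close> iterations, run through
  states whose entries have size at most \<open>B\<close>.\<close>

fun time_bound :: "nat \<Rightarrow> com \<Rightarrow> nat" where
  "time_bound B Skip = 1"
| "time_bound B (Assign a i e) = 1 + (acoeff i + acoeff e) * B"
| "time_bound B (Seq c c') = time_bound B c + time_bound B c'"
| "time_bound B (Cond b c c') = bcoeff b * B + time_bound B c + time_bound B c'"
| "time_bound B (While b c) = bcoeff b * B + B * (bcoeff b * B + time_bound B c)"

fun written :: "com \<Rightarrow> nat set" where
  "written Skip = {}"
| "written (Assign a i e) = {a}"
| "written (Seq c c') = written c \<union> written c'"
| "written (Cond b c c') = written c \<union> written c'"
| "written (While b c) = written c"

lemma time_bound_poly: "\<exists>p. \<forall>B. time_bound B c = poly p B"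
proof (induction c)
  case Skip
  have "\<forall>B. time_bound B Skip = poly [:1:] B" by simp
  then show ?case by blast
next
  case (Assign a i e)
  have "\<forall>B. time_bound B (Assign a i e) = poly [:1, acoeff i + acoeff e:] B" by (simp add: algebra_simps)
  then show ?case by blast
next
  case (Seq c c')
  then obtain p q where "\<forall>B. time_bound B c = poly p B" "\<forall>B. time_bound B c' = poly q B" by blast
  then have "\<forall>B. time_bound B (Seq c c') = poly (p + q) B" by simp
  then show ?case by blast
next
  case (Cond b c c')
  then obtain p q where "\<forall>B. time_bound B c = poly p B" "\<forall>B. time_bound B c' = poly q B" by blast
  then have "\<forall>B. time_bound B (Cond b c c') = poly ([:0, bcoeff b:] + p + q) B" by simp
  then show ?case by blast
next
  case (While b c)
  then obtain p where "\<forall>B. time_bound B c = poly p B" by blast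
  then have "\<forall>B. time_bound B (While b c)
      = poly ([:0, bcoeff b:] + [:0, 1:] * ([:0, bcoeff b:] + p)) B"
    by (simp add: algebra_simps)
  then show ?case by blast
qed

lemma log_height_aval:
  assumes "bounded_state B s"
  shows "log_height (aval e s) \<le> leaves e * B"
proof (induction e)
  case (Const r)
  have "rat_size r \<le> rat_size r * B" using assms by (simp add: bounded_state_def)
  then show ?case using log_height_le_rat_size[of r] unfolding aval.simps leaves.simps by linarith
next
  case (Read a e)
  then show ?case using assms log_height_le_rat_size order_trans
    by (fastforce simp: bounded_state_def)
next
  case (Add e e')
  then show ?case using log_height_add[of "aval e s" "aval e' s"] by (simp add: algebra_simps)
next
  case (Sub e e')
  then show ?case using log_height_diff[of "aval e s" "aval e' s"] by (simp add: algebra_simps)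
next
  case (Mul e e')
  then show ?case using log_height_mult[of "aval e s" "aval e' s"] by (simp add: algebra_simps)
next
  case (Div e e')
  then show ?case using log_height_divide[of "aval e s" "aval e' s"] by (simp add: algebra_simps)
qed

lemma rat_size_aval:
  assumes "bounded_state B s"
  shows "rat_size (aval e s) \<le> B + 2 * leaves e * B"
  using rat_size_le_log_height[of "aval e s"] log_height_aval[OF assms, of e] assms
  by (simp add: bounded_state_def)

lemma acost_le:
  assumes "bounded_state B s"
  shows "acost e s \<le> acoeff e * B"
proof (induction e)
  case (Const r)
  then show ?case using assms by (simp add: bounded_state_def)
next
  case (Read a e)
  have "rat_size (aval (Read a e) s) \<le> B" using assms by (simp add: bounded_state_def)
  then show ?case using Read by simp
next
  case (Add e e')
  then show ?case using rat_size_aval[OF assms, of "Add e e'"] by (simp add: algebra_simps)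
next
  case (Sub e e')
  then show ?case using rat_size_aval[OF assms, of "Sub e e'"] by (simp add: algebra_simps)
next
  case (Mul e e')
  then show ?case using rat_size_aval[OF assms, of "Mul e e'"] by (simp add: algebra_simps)
next
  case (Div e e')
  then show ?case using rat_size_aval[OF assms, of "Div e e'"] by (simp add: algebra_simps)
qed

lemma bcost_le:
  assumes "bounded_state B s"
  shows "bcost b s \<le> bcoeff b * B"
proof (induction b)
  case (Leq e e')
  then show ?case using acost_le[OF assms, of e] acost_le[OF assms, of e'] assms
    by (simp add: bounded_state_def algebra_simps)
qed (use assms in \<open>simp_all add: bounded_state_def algebra_simps\<close>)

text \<open>Correctness, cost and size bound travel together, since the size bound of an
  intermediate state is what limits the cost of the next command. The frame condition is built in,
  so that loop invariants need only speak about what the loop changes.\<close>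

definition wp :: "nat \<Rightarrow> com \<Rightarrow> state \<Rightarrow> (state \<Rightarrow> bool) \<Rightarrow> bool" where
  "wp B c s Q \<longleftrightarrow> (bounded_state B s \<longrightarrow>
     (\<exists>t s'. exec c s t s' \<and> t \<le> time_bound B c \<and> bounded_state B s' \<and>
        (\<forall>a. a \<notin> written c \<longrightarrow> s' a = s a) \<and> Q s'))"

lemma wp_mono:
  assumes "wp B c s Q"
    and "\<And>s'. \<forall>a. a \<notin> written c \<longrightarrow> s' a = s a \<Longrightarrow> Q s' \<Longrightarrow> Q' s'"
  shows "wp B c s Q'"
  using assms unfolding wp_def by blast

lemma wp_Skip: "Q s \<Longrightarrow> wp B Skip s Q"
  by (auto simp: wp_def intro!: exec.Skip exI)

lemma wp_Assign:
  assumes "rat_size (aval e s) \<le> B" "Q (s(a := (s a)(address (aval i s) := aval e s)))"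
  shows "wp B (Assign a i e) s Q"
  unfolding wp_def
proof
  assume b: "bounded_state B s"
  then have "1 + acost i s + acost e s \<le> time_bound B (Assign a i e)"
    using acost_le[OF b, of i] acost_le[OF b, of e] by (simp add: algebra_simps)
  moreover have "bounded_state B (s(a := (s a)(address (aval i s) := aval e s)))"
    using b assms(1) by (auto simp: bounded_state_def)
  ultimately show "\<exists>t s'. exec (Assign a i e) s t s' \<and> t \<le> time_bound B (Assign a i e) \<and>
      bounded_state B s' \<and> (\<forall>a'. a' \<notin> written (Assign a i e) \<longrightarrow> s' a' = s a') \<and> Q s'"
    using exec.Assign[of a i e s] assms(2) by fastforce
qed

lemma wp_Seq:
  assumes "wp B c s (\<lambda>s'. wp B c' s' Q)"
  shows "wp B (Seq c c') s Q"
  unfolding wp_def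
proof
  assume "bounded_state B s"
  with assms obtain t s' where 1: "exec c s t s'" "t \<le> time_bound B c" "bounded_state B s'"
    "\<forall>a. a \<notin> written c \<longrightarrow> s' a = s a" "wp B c' s' Q" unfolding wp_def[of B c] by blast
  then obtain t' s'' where 2: "exec c' s' t' s''" "t' \<le> time_bound B c'" "bounded_state B s''"
    "\<forall>a. a \<notin> written c' \<longrightarrow> s'' a = s' a" "Q s''" unfolding wp_def by blast
  show "\<exists>t s'. exec (Seq c c') s t s' \<and> t \<le> time_bound B (Seq c c') \<and>
      bounded_state B s' \<and> (\<forall>a'. a' \<notin> written (Seq c c') \<longrightarrow> s' a' = s a') \<and> Q s'"
    using exec.Seq[OF 1(1) 2(1)] 1 2 by (intro exI[of _ "t + t'"] exI[of _ s'']) auto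
qed

lemma wp_Cond:
  assumes "bval b s \<Longrightarrow> wp B c s Q" "\<not> bval b s \<Longrightarrow> wp B c' s Q"
  shows "wp B (Cond b c c') s Q"
  unfolding wp_def
proof
  assume bd: "bounded_state B s"
  note bc = bcost_le[OF bd, of b]
  show "\<exists>t s'. exec (Cond b c c') s t s' \<and> t \<le> time_bound B (Cond b c c') \<and>
      bounded_state B s' \<and> (\<forall>a'. a' \<notin> written (Cond b c c') \<longrightarrow> s' a' = s a') \<and> Q s'"
  proof (cases "bval b s")
    case True
    with assms(1) bd obtain t s' where 1: "exec c s t s'" "t \<le> time_bound B c" "bounded_state B s'"
      "\<forall>a. a \<notin> written c \<longrightarrow> s' a = s a" "Q s'" unfolding wp_def by blast
    show ?thesis using exec.CondTrue[OF True 1(1)] 1 bc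
      by (intro exI[of _ "bcost b s + t"] exI[of _ s']) auto
  next
    case False
    with assms(2) bd obtain t s' where 1: "exec c' s t s'" "t \<le> time_bound B c'" "bounded_state B s'"
      "\<forall>a. a \<notin> written c' \<longrightarrow> s' a = s a" "Q s'" unfolding wp_def by blast
    show ?thesis using exec.CondFalse[OF False 1(1)] 1 bc
      by (intro exI[of _ "bcost b s + t"] exI[of _ s']) auto
  qed
qed

text \<open>The invariant is indexed by the iteration, and the loop makes exactly k of them;
  induction is on the number of remaining ones. The separate summand of the time bound is the final
  failing test.\<close>

lemma exec_While_steps:
  assumes "bounded_state B s" "J i s" "i \<le> k"
    and step: "\<And>i s. i < k \<Longrightarrow> bounded_state B s \<Longrightarrow> J i s \<Longrightarrow> bval b s \<and> wp B c s (J (Suc i))"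
    and stop: "\<And>s. J k s \<Longrightarrow> \<not> bval b s"
  shows "\<exists>t s'. exec (While b c) s t s' \<and>
    t \<le> bcoeff b * B + (k - i) * (bcoeff b * B + time_bound B c) \<and> bounded_state B s' \<and>
    (\<forall>a. a \<notin> written c \<longrightarrow> s' a = s a) \<and> J k s'"
  using assms(1-3)
proof (induction "k - i" arbitrary: i s)
  case 0
  then have "i = k" by simp
  with 0 have "exec (While b c) s (bcost b s) s" using stop exec.WhileFalse by blast
  then show ?case using 0 bcost_le[of B s b] \<open>i = k\<close> by auto
next
  case (Suc x)
  then have "i < k" by simp
  with step Suc have b: "bval b s" and w: "wp B c s (J (Suc i))" by auto
  from w Suc obtain t s' where 1: "exec c s t s'" "t \<le> time_bound B c" "bounded_state B s'"
    "\<forall>a. a \<notin> written c \<longrightarrow> s' a = s a" "J (Suc i) s'" unfolding wp_def by blast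
  have x: "x = k - Suc i" using Suc(2) by simp
  obtain t' s'' where 2: "exec (While b c) s' t' s''"
    "t' \<le> bcoeff b * B + (k - Suc i) * (bcoeff b * B + time_bound B c)" "bounded_state B s''"
    "\<forall>a. a \<notin> written c \<longrightarrow> s'' a = s' a" "J k s''"
    using Suc(1)[OF x 1(3) 1(5)] \<open>i < k\<close> by auto
  have "k - i = Suc (k - Suc i)" using \<open>i < k\<close> by simp
  then have "bcost b s + t + t' \<le> bcoeff b * B + (k - i) * (bcoeff b * B + time_bound B c)"
    using 1(2) 2(2) bcost_le[OF Suc(3), of b] by simp
  then show ?case using exec.WhileTrue[OF b 1(1) 2(1)] 1 2
    by (intro exI[of _ "bcost b s + t + t'"] exI[of _ s'']) auto
qed

abbreviation Var :: "nat \<Rightarrow> aexp" where "Var x \<equiv> Read x (Const 0)"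

abbreviation Set :: "nat \<Rightarrow> aexp \<Rightarrow> com" where "Set x e \<equiv> Assign x (Const 0) e"

abbreviation seq :: "com \<Rightarrow> com \<Rightarrow> com" (infixr ";;" 60) where "c ;; c' \<equiv> Seq c c'"

definition For :: "nat \<Rightarrow> aexp \<Rightarrow> com \<Rightarrow> com" where
  "For x e c = Set x (Const 0) ;;
     While (Neg (Leq e (Var x))) (c ;; Set x (Add (Var x) (Const 1)))"

lemma written_For[simp]: "written (For x e c) = insert x (written c)"
  by (auto simp: For_def)

lemma address_of_nat[simp]: "address (of_nat k) = k"
  by (simp add: address_def)

lemma address_0[simp]: "address 0 = 0"
  by (simp add: address_def)

text \<open>The counter is incremented after the body, so the invariant must not depend on its cell
  0; this is \<open>indep\<close>. The loop bound e is evaluated anew at each test, hence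
  \<open>bound\<close> for all reachable states. The 2 in \<open>k + 2 \<le> B\<close> leaves room
  for the size of the final counter value k.\<close>

lemma wp_For:
  fixes I :: "nat \<Rightarrow> state \<Rightarrow> bool" and k :: nat
  assumes k: "k + 2 \<le> B" and x: "x \<notin> written c"
    and init: "\<And>r. I 0 (s(x := (s x)(0 := r)))"
    and indep: "\<And>i s r. I i s \<Longrightarrow> I i (s(x := (s x)(0 := r)))"
    and bound: "\<And>i s'. i \<le> k \<Longrightarrow> I i s' \<Longrightarrow> \<forall>a. a \<notin> insert x (written c) \<longrightarrow> s' a = s a \<Longrightarrow>
      aval e s' = of_nat k"
    and body: "\<And>i s'. i < k \<Longrightarrow> I i s' \<Longrightarrow> \<forall>a. a \<notin> insert x (written c) \<longrightarrow> s' a = s a \<Longrightarrow>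
      s' x 0 = of_nat i \<Longrightarrow> wp B c s' (I (Suc i))"
    and post: "\<And>s'. I k s' \<Longrightarrow> \<forall>a. a \<notin> insert x (written c) \<longrightarrow> s' a = s a \<Longrightarrow> Q s'"
  shows "wp B (For x e c) s Q"
proof -
  define J where "J i s' \<longleftrightarrow> i \<le> k \<and> I i s' \<and> (\<forall>a. a \<notin> insert x (written c) \<longrightarrow> s' a = s a)
    \<and> s' x 0 = of_nat i" for i s'
  define s0 where "s0 = s(x := (s x)(0 := 0))"
  let ?b = "Neg (Leq e (Var x))" and ?c = "c ;; Set x (Add (Var x) (Const 1))"
  have size: "rat_size (of_nat i) \<le> B" if "i \<le> k" for i
    using rat_size_of_nat_le[of i] that k by linarith
  have J0: "J 0 s0" using init by (auto simp: J_def s0_def)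
  have step: "bval ?b s' \<and> wp B ?c s' (J (Suc i))" if "i < k" "J i s'" for i s'
  proof
    show "bval ?b s'" using that bound[of i s'] by (auto simp: J_def)
    have "wp B c s' (I (Suc i))" using that body[of i s'] by (auto simp: J_def)
    then show "wp B ?c s' (J (Suc i))"
    proof (intro wp_Seq, elim wp_mono)
      fix s'' assume fr: "\<forall>a. a \<notin> written c \<longrightarrow> s'' a = s' a" and "I (Suc i) s''"
      moreover have "s'' x 0 = of_nat i" using that fr x by (auto simp: J_def)
      moreover have "rat_size (of_nat i + 1) \<le> B" using size[of "Suc i"] that by (simp add: add.commute)
      ultimately show "wp B (Set x (Add (Var x) (Const 1))) s'' (J (Suc i))"
        using that indep[of "Suc i" s'']
        by (intro wp_Assign) (auto simp: J_def)
    qed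
  qed
  have stop: "\<not> bval ?b s'" if "J k s'" for s' using that bound[of k s'] by (auto simp: J_def)
  have "wp B (While ?b ?c) s0 Q"
    unfolding wp_def
  proof
    assume bd: "bounded_state B s0"
    obtain t s' where *: "exec (While ?b ?c) s0 t s'"
      "t \<le> bcoeff ?b * B + k * (bcoeff ?b * B + time_bound B ?c)" "bounded_state B s'"
      "\<forall>a. a \<notin> written ?c \<longrightarrow> s' a = s0 a" "J k s'"
      using exec_While_steps[of B s0 J 0 k ?b ?c, OF bd J0 _ step stop] by auto
    have "k * (bcoeff ?b * B + time_bound B ?c) \<le> B * (bcoeff ?b * B + time_bound B ?c)"
      using k by (intro mult_le_mono1) simp
    with *(2) have "t \<le> time_bound B (While ?b ?c)" unfolding time_bound.simps(5) by linarith
    moreover have "Q s'" using *(5) post by (auto simp: J_def)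
    ultimately show "\<exists>t s'. exec (While ?b ?c) s0 t s' \<and> t \<le> time_bound B (While ?b ?c) \<and>
      bounded_state B s' \<and> (\<forall>a'. a' \<notin> written (While ?b ?c) \<longrightarrow> s' a' = s0 a') \<and> Q s'"
      using * by (metis written.simps(5))
  qed
  then show ?thesis unfolding For_def
    using size[of 0] by (intro wp_Seq wp_Assign) (auto simp: s0_def)
qed

section \<open>Rounded weights and choices from disjoint balls\<close>

fun horner :: "nat \<Rightarrow> (nat \<Rightarrow> nat) \<Rightarrow> nat \<Rightarrow> nat" where
  "horner b f 0 = 0"
| "horner b f (Suc j) = horner b f j * b + f j"

lemma horner_less: "(\<And>j. j < m \<Longrightarrow> f j < b) \<Longrightarrow> horner b f m < b ^ m"
proof (induction m)
  case (Suc m)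
  have "horner b f m < b ^ m" using Suc by simp
  then have "Suc (horner b f m) * b \<le> b ^ m * b" by (intro mult_le_mono1) simp
  then show ?case using Suc(2)[of m] by (simp add: algebra_simps)
qed simp

text \<open>The last digit is the remainder modulo b; cancelling it leaves the same equation for the
  leading digits.\<close>

lemma horner_inject:
  assumes "\<And>j. j < m \<Longrightarrow> f j < b" "\<And>j. j < m \<Longrightarrow> g j < b" "horner b f m = horner b g m" "j < m"
  shows "f j = g j"
  using assms
proof (induction m)
  case (Suc m)
  have b: "f m < b" "g m < b" using Suc by auto
  have "f m = horner b f (Suc m) mod b" using b by simp
  also have "\<dots> = g m" unfolding Suc(4) using b by simp
  finally have m: "f m = g m" .
  then have "horner b f m = horner b g m" using Suc(4) b by simp
  then show ?case using Suc m by (cases "j = m") auto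
qed simp

text \<open>Horner's form is linear in the digits, whatever their size. The base matters only when
  digits are recovered from a code.\<close>

lemma horner_sum: "horner b (\<lambda>j. \<Sum>v\<in>S. f v j) m = (\<Sum>v\<in>S. horner b (f v) m)"
  by (induction m) (simp_all add: sum.distrib sum_distrib_right)

text \<open>A table cell can thus hold a whole set as one number of n bits, and adding a new point
  is a single addition.\<close>

definition set_mask :: "nat set \<Rightarrow> nat" where
  "set_mask S = (\<Sum>v\<in>S. 2 ^ v)"

lemma set_mask_less: "set_mask (S \<inter> {..<k}) < 2 ^ k"
proof -
  have "set_mask (S \<inter> {..<k}) \<le> set_mask {..<k}" unfolding set_mask_def by (intro sum_mono2) auto
  also have "\<dots> < 2 ^ k" unfolding set_mask_def by (induction k) auto
  finally show ?thesis .
qed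

lemma set_mask_Suc: "set_mask (S \<inter> {..<Suc k}) = set_mask (S \<inter> {..<k}) + (if k \<in> S then 2 ^ k else 0)"
proof -
  have "S \<inter> {..<Suc k} = (if k \<in> S then insert k (S \<inter> {..<k}) else S \<inter> {..<k})"
    by (auto simp: less_Suc_eq)
  then show ?thesis by (simp add: set_mask_def)
qed

lemma set_mask_insert: "finite S \<Longrightarrow> v \<notin> S \<Longrightarrow> set_mask (insert v S) = set_mask S + 2 ^ v"
  by (simp add: set_mask_def)

locale knapsack_data =
  fixes m n N :: nat and d :: "nat \<Rightarrow> nat \<Rightarrow> rat" and w :: "nat \<Rightarrow> nat \<Rightarrow> rat" and L :: "nat \<Rightarrow> rat"
  assumes N_pos: "0 < N" and m_pos: "0 < m"
    and d_nonneg: "u < n \<Longrightarrow> v < n \<Longrightarrow> 0 \<le> d u v"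
    and d_self: "v < n \<Longrightarrow> d v v = 0"
    and d_sym: "u < n \<Longrightarrow> v < n \<Longrightarrow> d u v = d v u"
    and d_triangle: "u < n \<Longrightarrow> v < n \<Longrightarrow> x < n \<Longrightarrow> d u x \<le> d u v + d v x"
    and w_nonneg: "j < m \<Longrightarrow> v < n \<Longrightarrow> 0 \<le> w j v"
begin

definition K :: nat where "K = N * n"

text \<open>At most n digits, each at most \<open>K\<close>, are added in one position.\<close>

definition base :: nat where "base = n * K + 1"

definition good :: "nat \<Rightarrow> bool" where
  "good v \<longleftrightarrow> (\<forall>j<m. w j v \<le> L j)"

text \<open>If \<open>L j = 0\<close>, division by zero gives digit 0, which loses nothing: a good
  point then has weight 0 in constraint j. The default 0 for overweight points matches the program,
  which then only shifts the code.\<close>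

definition digit :: "nat \<Rightarrow> nat \<Rightarrow> nat" where
  "digit v j = (if w j v \<le> L j then nat \<lfloor>w j v * of_nat K / L j\<rfloor> else 0)"

definition code :: "nat \<Rightarrow> nat" where
  "code v = horner base (digit v) m"

text \<open>The choice function is hidden, as the table records only the chosen set. That distinct
  pivots receive distinct points is supplied by \<open>choices_fresh\<close>.\<close>

definition choices :: "rat \<Rightarrow> nat set \<Rightarrow> nat set set" where
  "choices r P = {f ` P | f. \<forall>p\<in>P. f p < n \<and> good (f p) \<and> d p (f p) \<le> r}"

fun pivots :: "rat \<Rightarrow> nat \<Rightarrow> nat set" where
  "pivots r 0 = {}"
| "pivots r (Suc p) =
     (if \<exists>u\<in>pivots r p. d p u \<le> 2 * r then pivots r p else insert p (pivots r p))"

lemma pivots_less: "pivots r p \<subseteq> {..<p}"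
  by (induction p) (auto simp: less_Suc_eq)

lemma pivots_cover:
  assumes "0 \<le> r" "p \<le> n" "v < p"
  shows "\<exists>u\<in>pivots r p. d v u \<le> 2 * r"
  using assms
proof (induction p)
  case (Suc p)
  then show ?case using d_self[of p] by (cases "v = p") auto
qed simp

lemma choices_empty: "choices r {} = {{}}"
  by (auto simp: choices_def)

lemma choices_insertI:
  assumes "p \<notin> P" "S \<in> choices r P" "v < n" "good v" "d p v \<le> r"
  shows "insert v S \<in> choices r (insert p P)"
proof -
  obtain f where f: "S = f ` P" "\<forall>p\<in>P. f p < n \<and> good (f p) \<and> d p (f p) \<le> r"
    using assms by (auto simp: choices_def)
  have "insert v S = (f(p := v)) ` insert p P" using f assms by auto
  moreover have "\<forall>q\<in>insert p P. (f(p := v)) q < n \<and> good ((f(p := v)) q) \<and> d q ((f(p := v)) q) \<le> r"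
    using f assms by auto
  ultimately show ?thesis unfolding choices_def by blast
qed

lemma choices_insertE:
  assumes "S \<in> choices r (insert p P)"
  obtains T v where "T \<in> choices r P" "v < n" "good v" "d p v \<le> r" "S = insert v T"
proof -
  obtain f where f: "S = f ` insert p P" "\<forall>q\<in>insert p P. f q < n \<and> good (f q) \<and> d q (f q) \<le> r"
    using assms by (auto simp: choices_def)
  then have "f ` P \<in> choices r P" "S = insert (f p) (f ` P)" unfolding choices_def by auto
  then show thesis using that f by blast
qed

text \<open>A point within r of both p and an earlier pivot would place them within 2 r of each
  other. Hence v is new, and inserting it adds its code and weight exactly once.\<close>

lemma choices_fresh:
  assumes "insert p P \<subseteq> {..<n}" "\<And>u. u \<in> P \<Longrightarrow> 2 * r < d p u"
    "S \<in> choices r P" "v < n" "d p v \<le> r"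
  shows "v \<notin> S"
proof
  assume "v \<in> S"
  with assms obtain u where u: "u \<in> P" "d u v \<le> r" by (auto simp: choices_def)
  then have "d p u \<le> r + r"
    using assms d_triangle[of p v u] d_sym[of u v] by fastforce
  then show False using assms(2)[OF u(1)] by simp
qed

lemma choices_subset: "S \<in> choices r P \<Longrightarrow> S \<subseteq> {v. v < n \<and> good v}"
  by (auto simp: choices_def)

lemma choices_finite: "S \<in> choices r P \<Longrightarrow> finite S"
  using choices_subset finite_subset by fastforce

lemma choices_cover:
  assumes "0 \<le> r" "S \<in> choices r (pivots r n)" "v < n"
  shows "\<exists>u\<in>S. d v u \<le> 3 * r"
proof -
  obtain p where p: "p \<in> pivots r n" "d v p \<le> 2 * r" using pivots_cover assms by blast
  obtain u where u: "u \<in> S" "u < n" "d p u \<le> r" using p assms by (auto simp: choices_def)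
  have "p < n" using p pivots_less by auto
  then have "d v u \<le> d v p + d p u" using d_triangle assms u by blast
  then show ?thesis using u p by force
qed

lemma digit_floor:
  assumes "j < m" "v < n" "w j v \<le> L j"
  shows "of_nat (digit v j) \<le> w j v * of_nat K / L j" "w j v * of_nat K / L j < of_nat (digit v j) + 1"
    "digit v j \<le> K"
proof -
  let ?x = "w j v * of_nat K / L j"
  have w: "0 \<le> w j v" using w_nonneg assms by simp
  have x0: "0 \<le> ?x" using w assms by simp
  have dg: "digit v j = nat \<lfloor>?x\<rfloor>" using assms by (simp add: digit_def)
  have eq: "of_nat (digit v j) = (of_int \<lfloor>?x\<rfloor> :: rat)" using x0 by (simp add: dg)
  show "of_nat (digit v j) \<le> ?x" "?x < of_nat (digit v j) + 1" unfolding eq by linarith+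
  have "?x \<le> of_nat K"
  \<comment> \<open>The quotient is 0 when the budget is 0, by the convention on division.\<close>
  proof (cases "L j = 0")
    case False
    then have "0 < L j" using w assms by linarith
    then show ?thesis using assms by (simp add: divide_le_eq mult_mono mult.commute)
  qed simp
  with \<open>of_nat (digit v j) \<le> ?x\<close> have "(of_nat (digit v j) :: rat) \<le> of_nat K" by linarith
  then show "digit v j \<le> K" by simp
qed

lemma digit_le: "j < m \<Longrightarrow> v < n \<Longrightarrow> digit v j \<le> K"
  using digit_floor(3) by (cases "w j v \<le> L j") (auto simp: digit_def)

lemma sum_digit_less:
  assumes "S \<subseteq> {..<n}" "j < m"
  shows "(\<Sum>v\<in>S. digit v j) < base"
proof -
  have "(\<Sum>v\<in>S. digit v j) \<le> (\<Sum>v\<in>S. K)" using assms digit_le by (intro sum_mono) auto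
  also have "\<dots> \<le> n * K" using card_mono[OF _ assms(1)] by simp
  finally show ?thesis by (simp add: base_def)
qed

lemma sum_code: "(\<Sum>v\<in>S. code v) = horner base (\<lambda>j. \<Sum>v\<in>S. digit v j) m"
  unfolding code_def by (simp add: horner_sum)

lemma sum_code_less: "S \<subseteq> {..<n} \<Longrightarrow> (\<Sum>v\<in>S. code v) < base ^ m"
  unfolding sum_code by (intro horner_less sum_digit_less)

text \<open>In units of \<open>L j / K\<close>, the weight of T is at most its digit sum plus one
  per point. The digit sum is that of S, which is at most the scaled weight of S and so at most K.
  This gives at most K + n units, that is (1 + n / K) budgets.\<close>

lemma sum_weight_le_of_code_eq:
  assumes S: "S \<subseteq> {v. v < n \<and> good v}" and T: "T \<subseteq> {v. v < n \<and> good v}"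
    and eq: "(\<Sum>v\<in>S. code v) = (\<Sum>v\<in>T. code v)"
    and j: "j < m" and le: "(\<Sum>v\<in>S. w j v) \<le> L j"
  shows "(\<Sum>v\<in>T. w j v) \<le> (1 + 1 / of_nat N) * L j"
proof -
  have fin: "finite S" "finite T" using S T finite_subset by fastforce+
  have dig: "(\<Sum>v\<in>S. digit v j) = (\<Sum>v\<in>T. digit v j)"
    using eq S T j unfolding sum_code
    by (intro horner_inject[of m "\<lambda>j. \<Sum>v\<in>S. digit v j" base "\<lambda>j. \<Sum>v\<in>T. digit v j"] sum_digit_less) auto
  have "0 \<le> (\<Sum>v\<in>S. w j v)" using S w_nonneg j by (intro sum_nonneg) auto
  then have L0: "0 \<le> L j" using le by linarith
  show ?thesis
  proof (cases "L j = 0")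
    case True
    \<comment> \<open>Scaling by a zero budget carries no information; here goodness alone forces
      the weights to vanish.\<close>
    then have "w j v = 0" if "v \<in> T" for v
      using that T w_nonneg[of j v] j unfolding good_def by force
    then show ?thesis using True by simp
  next
    case False
    then have L: "0 < L j" using L0 by simp
    show ?thesis
    proof (cases "n = 0")
      case True
      then have "T = {}" using T by auto
      then show ?thesis using L0 by simp
    next
      case n: False
      then have K: "0 < K" using N_pos by (simp add: K_def)
      have "(\<Sum>v\<in>T. w j v) * of_nat K / L j = (\<Sum>v\<in>T. w j v * of_nat K / L j)"
        by (simp add: sum_distrib_right sum_divide_distrib)
      also have "\<dots> \<le> (\<Sum>v\<in>T. of_nat (digit v j) + 1)"
        using T j digit_floor(2) by (intro sum_mono less_imp_le) (auto simp: good_def)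
      also have "\<dots> = (\<Sum>v\<in>S. of_nat (digit v j)) + of_nat (card T)"
        using dig by (simp add: sum.distrib flip: of_nat_sum)
      \<comment> \<open>For S rounding down goes in the favourable direction, so only T pays an
        error.\<close>
      also have "(\<Sum>v\<in>S. of_nat (digit v j)) \<le> (\<Sum>v\<in>S. w j v * of_nat K / L j)"
        using S j digit_floor(1) by (intro sum_mono) (auto simp: good_def)
      also have "\<dots> = (\<Sum>v\<in>S. w j v) * of_nat K / L j"
        by (simp add: sum_distrib_right sum_divide_distrib)
      also have "\<dots> \<le> of_nat K" using le L by (simp add: divide_le_eq mult_right_mono mult.commute)
      also have "(of_nat (card T) :: rat) \<le> of_nat n"
        using card_mono[of "{..<n}" T] T by (auto simp: subset_eq)
      finally have "(\<Sum>v\<in>T. w j v) * of_nat K / L j \<le> of_nat K + of_nat n" by simp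
      then have "(\<Sum>v\<in>T. w j v) * of_nat K \<le> (of_nat K + of_nat n) * L j"
        using L by (simp add: divide_le_eq)
      then have "(\<Sum>v\<in>T. w j v) \<le> (of_nat K + of_nat n) * L j / of_nat K"
        using K by (simp add: le_divide_eq)
      also have "\<dots> = (1 + 1 / of_nat N) * L j"
        using n N_pos by (simp add: K_def field_simps)
      finally show ?thesis .
    qed
  qed
qed

text \<open>Rational counterpart of the condition that the optimum is at most r.\<close>

definition covers :: "rat \<Rightarrow> bool" where
  "covers r \<longleftrightarrow> (\<exists>S\<subseteq>{..<n}. (\<forall>j<m. (\<Sum>v\<in>S. w j v) \<le> L j) \<and> (\<forall>v<n. \<exists>u\<in>S. d v u \<le> r))"

definition admissible :: "nat set \<Rightarrow> bool" where
  "admissible S \<longleftrightarrow> S \<subseteq> {..<n} \<and> (\<Sum>v\<in>S. w 0 v) \<le> L 0 \<and>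
     (\<forall>j<m. (\<Sum>v\<in>S. w j v) \<le> (1 + 1 / of_nat N) * L j)"

text \<open>Send each pivot to a center of the solution near it. The image is a subset of the
  solution, so it respects all budgets, and its points are good because a single weight is at most
  the sum. Any T with its code and no more weight in constraint 0 inherits that budget exactly and
  the others up to rounding.\<close>

lemma covers_choice:
  assumes "covers r" "P \<subseteq> {..<n}"
  obtains S where "S \<in> choices r P"
    "\<And>T. T \<subseteq> {v. v < n \<and> good v} \<Longrightarrow> (\<Sum>v\<in>T. code v) = (\<Sum>v\<in>S. code v) \<Longrightarrow>
      (\<Sum>v\<in>T. w 0 v) \<le> (\<Sum>v\<in>S. w 0 v) \<Longrightarrow> admissible T"
proof -
  obtain S where S: "S \<subseteq> {..<n}" "\<And>j. j < m \<Longrightarrow> (\<Sum>v\<in>S. w j v) \<le> L j"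
    "\<forall>v<n. \<exists>u\<in>S. d v u \<le> r"
    using assms by (auto simp: covers_def)
  then obtain f where f: "\<And>v. v < n \<Longrightarrow> f v \<in> S \<and> d v (f v) \<le> r" by metis
  have fin: "finite S" using S finite_subset by blast
  have nn: "0 \<le> w j v" if "j < m" "v \<in> S" for j v using that S w_nonneg by auto
  have good: "good v" if "v \<in> S" for v
    unfolding good_def
  proof (intro allI impI)
    fix j assume "j < m"
    then show "w j v \<le> L j" using S(2)[of j] member_le_sum[of v S "w j"] nn fin that by fastforce
  qed
  have sub: "f ` P \<subseteq> S" using f assms by auto
  then have ch: "f ` P \<in> choices r P" using f good assms S unfolding choices_def by blast
  have le: "(\<Sum>v\<in>f ` P. w j v) \<le> L j" if "j < m" for j
    using S(2)[OF that] sum_mono2[OF fin sub, of "w j"] nn that by force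
  show thesis
  proof (rule that[OF ch])
    fix T assume T: "T \<subseteq> {v. v < n \<and> good v}" "(\<Sum>v\<in>T. code v) = (\<Sum>v\<in>f ` P. code v)"
      "(\<Sum>v\<in>T. w 0 v) \<le> (\<Sum>v\<in>f ` P. w 0 v)"
    have "(\<Sum>v\<in>T. w j v) \<le> (1 + 1 / of_nat N) * L j" if "j < m" for j
      using sum_weight_le_of_code_eq[OF choices_subset[OF ch] T(1) T(2)[symmetric] that le[OF that]] .
    then show "admissible T" using T le[OF m_pos] unfolding admissible_def by auto
  qed
qed

end

section \<open>The program\<close>

text \<open>Array 0 holds the matrix of distances, the matrix of weights and the vector of budgets one
  after the other, all with rows of length \<open>n\<close>. Variables are arrays of which only cell 0 is used.\<close>

abbreviation (input) "vX \<equiv> 2 :: nat"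
abbreviation (input) "vI \<equiv> 3 :: nat"
abbreviation (input) "aIdx \<equiv> 4 :: nat"
abbreviation (input) "vV \<equiv> 5 :: nat"
abbreviation (input) "vJ \<equiv> 6 :: nat"
abbreviation (input) "aGood \<equiv> 7 :: nat"
abbreviation (input) "aCode \<equiv> 8 :: nat"
abbreviation (input) "aPow \<equiv> 9 :: nat"
abbreviation (input) "vQ \<equiv> 10 :: nat"
abbreviation (input) "vR \<equiv> 11 :: nat"
abbreviation (input) "vLay \<equiv> 12 :: nat"
abbreviation (input) "aW \<equiv> 13 :: nat"
abbreviation (input) "aM \<equiv> 14 :: nat"
abbreviation (input) "vP \<equiv> 15 :: nat"
abbreviation (input) "vU \<equiv> 16 :: nat"
abbreviation (input) "vPiv \<equiv> 17 :: nat"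
abbreviation (input) "aPiv \<equiv> 18 :: nat"
abbreviation (input) "vY \<equiv> 19 :: nat"
abbreviation (input) "vMk \<equiv> 20 :: nat"
abbreviation (input) "vOk \<equiv> 21 :: nat"
abbreviation (input) "vSum \<equiv> 22 :: nat"
abbreviation (input) "vFound \<equiv> 23 :: nat"
abbreviation (input) "vBest \<equiv> 24 :: nat"
abbreviation (input) "vBMask \<equiv> 25 :: nat"

text \<open>The offset 1 skips the cell that holds n, and \<open>Var 0\<close> reads that cell.
  Counted in rows of length n, weights begin at row n and budgets at row n + m, so one addressing
  scheme serves all three blocks.\<close>

definition Entry :: "aexp \<Rightarrow> aexp \<Rightarrow> aexp" where
  "Entry a b = Read 0 (Add (Add (Const 1) (Mul a (Var 0))) b)"

definition weight_entry :: "aexp \<Rightarrow> aexp \<Rightarrow> aexp" where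
  "weight_entry a b = Entry (Add (Var 0) a) b"

definition budget_entry :: "nat \<Rightarrow> aexp \<Rightarrow> aexp" where
  "budget_entry m a = Entry (Add (Var 0) (Const (of_nat m))) a"

definition K_exp :: "nat \<Rightarrow> aexp" where
  "K_exp N = Mul (Const (of_nat N)) (Var 0)"

definition base_exp :: "nat \<Rightarrow> aexp" where
  "base_exp N = Add (Mul (Var 0) (K_exp N)) (Const 1)"

text \<open>The exponent m is a constant of the program, so the power can be written out as one
  expression.\<close>

fun power_exp :: "aexp \<Rightarrow> nat \<Rightarrow> aexp" where
  "power_exp e 0 = Const 1"
| "power_exp e (Suc k) = Mul e (power_exp e k)"

lemma aval_power_exp[simp]: "aval (power_exp e k) s = aval e s ^ k"
  by (induction k) simp_all

text \<open>The machine rounds only addresses, so the array \<open>aIdx\<close> with \<open>aIdx[i] = i\<close> serves to compute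
  floors.\<close>

definition digit_step :: "nat \<Rightarrow> nat \<Rightarrow> com" where
  "digit_step m N =
     Cond (Leq (weight_entry (Var vJ) (Var vV)) (budget_entry m (Var vJ)))
       (Assign aCode (Var vV) (Add (Mul (Read aCode (Var vV)) (base_exp N))
          (Read aIdx (Div (Mul (weight_entry (Var vJ) (Var vV)) (K_exp N)) (budget_entry m (Var vJ))))))
       (Assign aGood (Var vV) (Const 0) ;;
        Assign aCode (Var vV) (Mul (Read aCode (Var vV)) (base_exp N)))"

definition prepare_point :: "nat \<Rightarrow> nat \<Rightarrow> com" where
  "prepare_point m N =
     Assign aPow (Add (Var vV) (Const 1)) (Mul (Const 2) (Read aPow (Var vV))) ;;
     Assign aGood (Var vV) (Const 1) ;;
     Assign aCode (Var vV) (Const 0) ;;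
     For vJ (Const (of_nat m)) (digit_step m N)"

definition prepare :: "nat \<Rightarrow> nat \<Rightarrow> com" where
  "prepare m N =
     Set vX (power_exp (base_exp N) m) ;;
     For vI (Add (K_exp N) (Const 1)) (Assign aIdx (Var vI) (Var vI)) ;;
     Set aPow (Const 1) ;;
     For vV (Var 0) (prepare_point m N)"

text \<open>The cells \<open>lay * X + y\<close> of \<open>aW\<close> and \<open>aM\<close> describe the best choice of code \<open>y\<close> in layer
  \<open>lay\<close>: the former is one more than its weight, the latter its bit mask. As layers are never
  reused, a cell of \<open>aW\<close> contains 0 until a choice has been found for it.\<close>

definition old_pos :: aexp where
  "old_pos = Add (Mul (Var vLay) (Var vX)) (Var vY)"

definition new_pos :: aexp where
  "new_pos = Add (Add (Mul (Add (Var vLay) (Const 1)) (Var vX)) (Var vY)) (Read aCode (Var vV))"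

definition new_weight :: aexp where
  "new_weight = Add (Read aW old_pos) (weight_entry (Const 0) (Var vV))"

definition improve :: com where
  "improve =
     Cond (Conj (Leq (Const 1) (Read aGood (Var vV))) (Leq (Entry (Var vP) (Var vV)) (Var vR)))
       (Cond (Conj (Leq (Const 1) (Read aW new_pos)) (Leq (Read aW new_pos) new_weight)) Skip
          (Assign aM new_pos (Add (Read aM old_pos) (Read aPow (Var vV))) ;;
           Assign aW new_pos new_weight))
       Skip"

definition next_layer :: com where
  "next_layer = For vY (Var vX) (Cond (Leq (Const 1) (Read aW old_pos)) (For vV (Var 0) improve) Skip)"

definition pivot_step :: com where
  "pivot_step =
     Set vPiv (Const 1) ;;
     For vU (Var vP)
       (Cond (Conj (Leq (Const 1) (Read aPiv (Var vU)))
                (Leq (Entry (Var vP) (Var vU)) (Mul (Const 2) (Var vR))))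
          (Set vPiv (Const 0)) Skip) ;;
     Assign aPiv (Var vP) (Var vPiv) ;;
     Cond (Leq (Const 1) (Var vPiv)) (next_layer ;; Set vLay (Add (Var vLay) (Const 1))) Skip"

text \<open>The layer counter moves first, away from the last layer of the previous radius. The new
  layer starts with the empty choice: code 0, weight 0 stored as 1, mask 0.\<close>

definition first_layer :: com where
  "first_layer =
     Set vLay (Add (Var vLay) (Const 1)) ;;
     Assign aW (Mul (Var vLay) (Var vX)) (Const 1) ;;
     Assign aM (Mul (Var vLay) (Var vX)) (Const 0)"

definition top_pos :: aexp where
  "top_pos = Sub (Sub (Var 0) (Const 1)) (Var vV)"

text \<open>Bits are extracted from the highest downwards, so that comparison with powers of two and
  subtraction suffice.\<close>

definition decode :: com where
  "decode = For vV (Var 0)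
     (Cond (Leq (Read aPow top_pos) (Var vMk))
        (Assign 1 top_pos (Const 1) ;; Set vMk (Sub (Var vMk) (Read aPow top_pos)))
        (Assign 1 top_pos (Const 0)))"

definition check :: "nat \<Rightarrow> nat \<Rightarrow> com" where
  "check m N = decode ;; Set vOk (Const 1) ;;
     For vJ (Const (of_nat m))
       (Set vSum (Const 0) ;;
        For vV (Var 0)
          (Set vSum (Add (Var vSum) (Mul (Read 1 (Var vV)) (weight_entry (Var vJ) (Var vV))))) ;;
        Cond (Leq (Var vSum) (Mul (Const (1 + 1 / of_nat N)) (budget_entry m (Var vJ))))
          Skip (Set vOk (Const 0)))"

definition scan :: "nat \<Rightarrow> nat \<Rightarrow> com" where
  "scan m N = For vY (Var vX)
     (Cond (Conj (Conj (Leq (Const 1) (Read aW old_pos))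
                    (Leq (Read aW old_pos) (Add (Const 1) (budget_entry m (Const 0)))))
              (Neg (Conj (Leq (Const 1) (Var vFound)) (Leq (Var vBest) (Var vR)))))
        (Set vMk (Read aM old_pos) ;; check m N ;;
         Cond (Leq (Const 1) (Var vOk))
           (Set vFound (Const 1) ;; Set vBest (Var vR) ;; Set vBMask (Read aM old_pos)) Skip)
        Skip)"

definition try_radius :: "nat \<Rightarrow> nat \<Rightarrow> com" where
  "try_radius m N = Set vR (Entry (Const 0) (Var vQ)) ;; first_layer ;;
     For vP (Var 0) pivot_step ;; scan m N"

text \<open>The last decoding is needed because the checks use array 1 as scratch space. If nothing
  was found, the best mask is still 0 and the empty set is returned.\<close>

definition knapsack_center :: "nat \<Rightarrow> nat \<Rightarrow> com" where
  "knapsack_center m N = prepare m N ;;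
     For vQ (Mul (Var 0) (Var 0)) (try_radius m N) ;;
     Set vMk (Var vBMask) ;; decode"

section \<open>Correctness\<close>

lemma wp_AssignI:
  assumes "aval i s = of_nat k" "aval e s = x" "rat_size x \<le> B" "Q (s(a := (s a)(k := x)))"
  shows "wp B (Assign a i e) s Q"
  using assms by (intro wp_Assign) simp_all

lemma wp_Set:
  assumes "aval e s = x" "rat_size x \<le> B" "Q (s(a := (s a)(0 := x)))"
  shows "wp B (Set a e) s Q"
  using assms by (intro wp_Assign) simp_all

lemma wp_Assign_Seq:
  assumes "aval i s = of_nat k" "aval e s = x" "rat_size x \<le> B" "wp B c (s(a := (s a)(k := x))) Q"
  shows "wp B (Assign a i e ;; c) s Q"
  using assms by (intro wp_Seq wp_AssignI)

lemma wp_SeqI: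
  assumes "wp B c s R" "\<And>s'. \<forall>a. a \<notin> written c \<longrightarrow> s' a = s a \<Longrightarrow> R s' \<Longrightarrow> wp B c' s' Q"
  shows "wp B (c ;; c') s Q"
  by (rule wp_Seq) (rule wp_mono[OF assms])

lemma aval_Read: "aval i s = of_nat k \<Longrightarrow> aval (Read a i) s = s a k"
  by simp

text \<open>\<open>X\<close>, n * n, n, m and K + 1 are loop bounds. The term n * n * (n + 1) bounds
  layer numbers: each of the n * n radii uses an initial layer and at most n more. The last two
  assumptions cover running sums of weights and table entries. Cell positions such as l * X + y are
  computed but never stored, so B does not bound them.\<close>

locale knapsack_run = knapsack_data +
  fixes A :: "nat \<Rightarrow> rat" and B :: nat
  assumes A_0: "A 0 = of_nat n"
    and A_dist: "u < n \<Longrightarrow> v < n \<Longrightarrow> A (1 + u * n + v) = d u v"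
    and A_weight: "j < m \<Longrightarrow> v < n \<Longrightarrow> A (1 + (n + j) * n + v) = w j v"
    and A_budget: "j < m \<Longrightarrow> A (1 + (n + m) * n + j) = L j"
    and B_X: "base ^ m + 4 \<le> B" and B_n: "n * n * (n + 1) + n + 4 \<le> B"
    and B_m: "m + 4 \<le> B" and B_K: "K + 4 \<le> B"
    and B_input: "rat_size (A i) \<le> B"
    and B_sum: "j < m \<Longrightarrow> S \<subseteq> {..<n} \<Longrightarrow> rat_size (\<Sum>v\<in>S. w j v) \<le> B"
    and B_sum1: "S \<subseteq> {..<n} \<Longrightarrow> rat_size (1 + (\<Sum>v\<in>S. w 0 v)) \<le> B"
begin

abbreviation X :: nat where "X \<equiv> base ^ m"

lemma size_of_nat: "k + 2 \<le> B \<Longrightarrow> rat_size (of_nat k) \<le> B"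
  using rat_size_of_nat_le[of k] by linarith

lemma size_0_1[simp]: "rat_size 0 \<le> B" "rat_size 1 \<le> B"
  using size_of_nat[of 0] size_of_nat[of 1] B_m by auto

text \<open>Masks stay below 2 ^ n, but the table of powers reaches 2 ^ n itself.\<close>

lemma size_power:
  assumes "k \<le> 2 ^ n"
  shows "rat_size (of_nat k) \<le> B"
proof -
  have "(2::nat) ^ n < 2 ^ Suc n" by simp
  then have "k < 2 ^ Suc n" using assms by linarith
  then show ?thesis using rat_size_of_nat_less_power[of k "Suc n"] B_n by linarith
qed

lemma aval_Entry:
  assumes "s 0 = A" "aval a s = of_nat i" "aval b s = of_nat v"
  shows "aval (Entry a b) s = A (1 + i * n + v)"
proof -
  have "aval (Add (Add (Const 1) (Mul a (Var 0))) b) s = of_nat (1 + i * n + v)"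
    using assms A_0 by simp
  then show ?thesis unfolding Entry_def using assms by (simp only: aval_Read)
qed

lemma aval_dist:
  assumes "s 0 = A" "aval a s = of_nat u" "aval b s = of_nat v" "u < n" "v < n"
  shows "aval (Entry a b) s = d u v"
  using aval_Entry[OF assms(1-3)] A_dist assms by simp

lemma aval_weight:
  assumes "s 0 = A" "aval a s = of_nat j" "aval b s = of_nat v" "j < m" "v < n"
  shows "aval (weight_entry a b) s = w j v"
  unfolding weight_entry_def using aval_Entry[of s "Add (Var 0) a" "n + j" b v] A_weight assms A_0 by simp

lemma aval_budget:
  assumes "s 0 = A" "aval a s = of_nat j" "j < m"
  shows "aval (budget_entry m a) s = L j"
  unfolding budget_entry_def
  using aval_Entry[of s "Add (Var 0) (Const (of_nat m))" "n + m" a j] A_budget assms A_0 by simp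

lemma aval_K: "s 0 = A \<Longrightarrow> aval (K_exp N) s = of_nat K"
  by (simp add: K_exp_def K_def A_0)

lemma aval_base: "s 0 = A \<Longrightarrow> aval (base_exp N) s = of_nat base"
  by (simp add: base_exp_def base_def aval_K A_0)

section \<open>Preparation: goodness and codes of points, powers of two\<close>

definition prepared :: "state \<Rightarrow> bool" where
  "prepared s \<longleftrightarrow> s 0 = A \<and> s vX 0 = of_nat X \<and>
     (\<forall>v<n. s aGood v = (if good v then 1 else 0) \<and> s aCode v = of_nat (code v) \<and>
        s aPow v = of_nat (2 ^ v))"

lemma prepared_cong:
  assumes "prepared s" "\<forall>a. a \<notin> W \<longrightarrow> s' a = s a" "W \<inter> {0, vX, aGood, aCode, aPow} = {}"
  shows "prepared s'"
proof -
  have "s' 0 = s 0" "s' vX = s vX" "s' aGood = s aGood" "s' aCode = s aCode" "s' aPow = s aPow"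
    using assms(2,3) by auto
  then show ?thesis using assms(1) by (simp add: prepared_def)
qed

lemma wp_digit_step:
  assumes "s 0 = A" "s vV 0 = of_nat v" "v < n" "s vJ 0 = of_nat j" "j < m"
    and idx: "\<forall>i\<le>K. s aIdx i = of_nat i"
    and code: "s aCode v = of_nat (horner base (digit v) j)"
  shows "wp B (digit_step m N) s (\<lambda>s'.
    s' aCode = (s aCode)(v := of_nat (horner base (digit v) (Suc j))) \<and>
    s' aGood = (if w j v \<le> L j then s aGood else (s aGood)(v := 0)))"
    (is "wp B _ s ?Q")
proof -
  have W: "aval (weight_entry (Var vJ) (Var vV)) s = w j v" using assms by (intro aval_weight) simp_all
  have L: "aval (budget_entry m (Var vJ)) s = L j" using assms by (intro aval_budget) simp_all
  have dl: "digit v i \<le> K" if "i < m" for i using digit_le that assms by simp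
  \<comment> \<open>Partial codes stay below \<open>X\<close> too, so every intermediate code fits
    the bound B.\<close>
  have "horner base (digit v) (Suc j) < base ^ Suc j"
  proof (rule horner_less)
    fix i assume "i < Suc j"
    moreover have "K \<le> n * K" using assms by simp
    ultimately show "digit v i < base" using dl[of i] assms unfolding base_def by linarith
  qed
  also have "base ^ Suc j \<le> X" using assms by (intro power_increasing) (auto simp: base_def)
  finally have size: "rat_size (of_nat (horner base (digit v) (Suc j))) \<le> B"
    using B_X by (intro size_of_nat) linarith
  show ?thesis unfolding digit_step_def
  proof (rule wp_Cond)
    assume "bval (Leq (weight_entry (Var vJ) (Var vV)) (budget_entry m (Var vJ))) s"
    then have le: "w j v \<le> L j" using W L by simp
    \<comment> \<open>The rounding of addresses is the floor in \<open>digit\<close>; since the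
      digit is at most \<open>K\<close>, the access falls into the initialised part of
      \<open>aIdx\<close>.\<close>
    have "address (w j v * of_nat K / L j) = digit v j" using le by (simp add: digit_def address_def)
    then have "aval (Add (Mul (Read aCode (Var vV)) (base_exp N))
          (Read aIdx (Div (Mul (weight_entry (Var vJ) (Var vV)) (K_exp N)) (budget_entry m (Var vJ))))) s
       = of_nat (horner base (digit v) (Suc j))"
      using assms dl[of j] W L by (simp add: aval_K aval_base)
    then show "wp B (Assign aCode (Var vV) (Add (Mul (Read aCode (Var vV)) (base_exp N))
          (Read aIdx (Div (Mul (weight_entry (Var vJ) (Var vV)) (K_exp N)) (budget_entry m (Var vJ)))))) s ?Q"
      using size le assms(2) by (auto intro: wp_AssignI[where k = v] simp del: aval.simps(3-6) horner.simps)
  next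
    assume "\<not> bval (Leq (weight_entry (Var vJ) (Var vV)) (budget_entry m (Var vJ))) s"
    then have le: "\<not> w j v \<le> L j" using W L by simp
    then have dg: "digit v j = 0" by (simp add: digit_def)
    define s1 where "s1 = s(aGood := (s aGood)(v := 0))"
    have s1: "s1 0 = A" "s1 vV 0 = of_nat v" "s1 aCode = s aCode" using assms by (auto simp: s1_def)
    show "wp B (Assign aGood (Var vV) (Const 0) ;;
        Assign aCode (Var vV) (Mul (Read aCode (Var vV)) (base_exp N))) s ?Q"
    proof (rule wp_Assign_Seq[where k = v and x = 0])
      show "wp B (Assign aCode (Var vV) (Mul (Read aCode (Var vV)) (base_exp N)))
        (s(aGood := (s aGood)(v := 0))) ?Q"
        unfolding s1_def[symmetric]
      proof (rule wp_AssignI[where k = v])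
        show "aval (Mul (Read aCode (Var vV)) (base_exp N)) s1 = of_nat (horner base (digit v) (Suc j))"
          using s1 code dg by (simp add: aval_base)
        show "?Q (s1(aCode := (s1 aCode)(v := of_nat (horner base (digit v) (Suc j)))))"
          using le by (simp add: s1_def)
      qed (use s1 size in simp_all)
    qed (use assms in simp_all)
  qed
qed

lemma written_digit_step[simp]: "written (digit_step m N) = {aCode, aGood}"
  by (auto simp: digit_step_def)

lemma wp_prepare_point:
  assumes "s 0 = A" "s vV 0 = of_nat v" "v < n" "\<forall>i\<le>K. s aIdx i = of_nat i" "s aPow v = of_nat (2 ^ v)"
  shows "wp B (prepare_point m N) s (\<lambda>s'. s' aPow = (s aPow)(Suc v := of_nat (2 ^ Suc v)) \<and>
    s' aGood = (s aGood)(v := (if good v then 1 else 0)) \<and> s' aCode = (s aCode)(v := of_nat (code v)))"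
    (is "wp B _ s ?Q")
proof -
  define H where "H j s' \<longleftrightarrow> s' aGood = (s aGood)(v := (if \<forall>i<j. w i v \<le> L i then 1 else 0)) \<and>
    s' aCode = (s aCode)(v := of_nat (horner base (digit v) j))" for j and s' :: state
  define s2 where "s2 = s(aPow := (s aPow)(Suc v := of_nat (2 ^ Suc v)),
    aGood := (s aGood)(v := 1), aCode := (s aCode)(v := 0))"
  have s2: "s2 0 = A" "s2 vV 0 = of_nat v" "\<forall>i\<le>K. s2 aIdx i = of_nat i" "H 0 s2"
    "s2 aPow = (s aPow)(Suc v := of_nat (2 ^ Suc v))"
    using assms by (auto simp: s2_def H_def)
  have "wp B (For vJ (Const (of_nat m)) (digit_step m N)) s2 ?Q"
  proof (rule wp_For[where I = H and k = m])
    fix i t assume i: "i < m" "H i t" "\<forall>a. a \<notin> insert vJ (written (digit_step m N)) \<longrightarrow> t a = s2 a"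
      "t vJ 0 = of_nat i"
    have t: "t 0 = A" "t vV 0 = of_nat v" "\<forall>i\<le>K. t aIdx i = of_nat i" using i(3) s2 by simp_all
    show "wp B (digit_step m N) t (H (Suc i))"
    proof (rule wp_mono[OF wp_digit_step[of t v i]])
      show "t aCode v = of_nat (horner base (digit v) i)" using i(2) by (simp add: H_def)
    qed (use i t assms(3) in \<open>auto simp: H_def less_Suc_eq\<close>)
  next
    fix t assume i: "H m t" "\<forall>a. a \<notin> insert vJ (written (digit_step m N)) \<longrightarrow> t a = s2 a"
    then have "t aPow = s2 aPow" by simp
    then show "?Q t" using i(1) s2(5) by (simp add: H_def good_def code_def)
  qed (use B_m s2(4) in \<open>simp_all add: H_def\<close>)
  moreover have "rat_size (of_nat (2 ^ Suc v)) \<le> B"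
    using assms by (intro size_power power_increasing) auto
  ultimately show ?thesis unfolding prepare_point_def using assms(2,5)
    by (intro wp_Assign_Seq[where i = "Add (Var vV) (Const 1)" and k = "Suc v" and x = "of_nat (2 ^ Suc v)"]
        wp_Assign_Seq[where k = v and x = 1] wp_Assign_Seq[where k = v and x = 0])
      (simp_all add: s2_def)
qed

lemma written_prepare_point[simp]: "written (prepare_point m N) = {aPow, aGood, aCode, vJ}"
  by (auto simp: prepare_point_def)

lemma wp_prepare:
  assumes "s 0 = A"
  shows "wp B (prepare m N) s prepared"
proof -
  define I where "I i s' \<longleftrightarrow> (\<forall>i'<i. s' aIdx i' = of_nat i')" for i :: nat and s' :: state
  \<comment> \<open>The power table runs one cell ahead of the others, as point v writes the power
    with exponent v + 1.\<close>
  define J where "J v s' \<longleftrightarrow> s' aPow v = of_nat (2 ^ v) \<and> (\<forall>u<v. s' aGood u = (if good u then 1 else 0) \<and>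
    s' aCode u = of_nat (code u) \<and> s' aPow u = of_nat (2 ^ u))" for v and s' :: state
  have points: "wp B (For vV (Var 0) (prepare_point m N)) s prepared"
    if s: "s 0 = A" "s vX 0 = of_nat X" "\<forall>i\<le>K. s aIdx i = of_nat i" "s aPow 0 = 1" for s
  proof (rule wp_For[where I = J and k = n])
    fix v t assume t: "v < n" "J v t" "t vV 0 = of_nat v"
      "\<forall>a. a \<notin> insert vV (written (prepare_point m N)) \<longrightarrow> t a = s a"
    then have t': "t 0 = A" "\<forall>i\<le>K. t aIdx i = of_nat i" using s by simp_all
    show "wp B (prepare_point m N) t (J (Suc v))"
      by (rule wp_mono[OF wp_prepare_point[of t v]])
        (use t t' in \<open>auto simp: J_def less_Suc_eq\<close>)
  qed (use B_n s A_0 in \<open>auto simp: J_def prepared_def\<close>)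
  show ?thesis unfolding prepare_def
  proof (rule wp_Assign_Seq[where k = 0 and x = "of_nat X"])
    show "rat_size (of_nat X) \<le> B" using B_X by (intro size_of_nat) simp
    let ?s = "s(vX := (s vX)(0 := of_nat X))"
    have "wp B (For vI (Add (K_exp N) (Const 1)) (Assign aIdx (Var vI) (Var vI))) ?s (I (K + 1))"
    proof (rule wp_For[where I = I and k = "K + 1"])
      fix i t assume "i < K + 1" "I i t" "t vI 0 = of_nat i"
      moreover from this have "rat_size (of_nat i) \<le> B" using B_K by (intro size_of_nat) simp
      ultimately show "wp B (Assign aIdx (Var vI) (Var vI)) t (I (Suc i))"
        by (intro wp_AssignI[where k = i and x = "of_nat i"]) (auto simp: I_def less_Suc_eq)
    qed (use B_K assms in \<open>auto simp: I_def aval_K\<close>)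
    then show "wp B (For vI (Add (K_exp N) (Const 1)) (Assign aIdx (Var vI) (Var vI)) ;;
      Set aPow (Const 1) ;; For vV (Var 0) (prepare_point m N)) ?s prepared"
    proof (rule wp_SeqI)
      fix t assume t: "\<forall>a. a \<notin> written (For vI (Add (K_exp N) (Const 1)) (Assign aIdx (Var vI) (Var vI))) \<longrightarrow> t a = ?s a"
        and "I (K + 1) t"
      then have "\<forall>i\<le>K. t aIdx i = of_nat i" "t 0 = A" "t vX 0 = of_nat X"
        using assms by (simp_all add: I_def)
      then show "wp B (Set aPow (Const 1) ;; For vV (Var 0) (prepare_point m N)) t prepared"
        by (intro wp_Assign_Seq[where k = 0 and x = 1] points) simp_all
    qed
  qed (simp_all add: aval_base assms)
qed

section \<open>One layer of the dynamic program\<close>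

definition entry :: "rat \<Rightarrow> nat set \<Rightarrow> nat \<Rightarrow> state \<Rightarrow> nat \<Rightarrow> nat set \<Rightarrow> bool" where
  "entry r P l s y S \<longleftrightarrow> S \<in> choices r P \<and> (\<Sum>v\<in>S. code v) = y \<and>
     s aW (l * X + y) = 1 + (\<Sum>v\<in>S. w 0 v) \<and> s aM (l * X + y) = of_nat (set_mask S)"

definition table_sound :: "rat \<Rightarrow> nat set \<Rightarrow> nat \<Rightarrow> state \<Rightarrow> bool" where
  "table_sound r P l s \<longleftrightarrow> (\<forall>y<X. s aW (l * X + y) = 0 \<or> (\<exists>S. entry r P l s y S))"

text \<open>The cell of a code may describe another choice than S. By soundness it is some choice
  with the same code, and here it is no heavier in constraint 0, which is what
  \<open>covers_choice\<close> asks for.\<close>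

definition table_complete :: "rat \<Rightarrow> nat set \<Rightarrow> nat \<Rightarrow> state \<Rightarrow> bool" where
  "table_complete r P l s \<longleftrightarrow> (\<forall>S\<in>choices r P. 1 \<le> s aW (l * X + (\<Sum>v\<in>S. code v)) \<and>
     s aW (l * X + (\<Sum>v\<in>S. code v)) \<le> 1 + (\<Sum>v\<in>S. w 0 v))"

definition fresh :: "nat \<Rightarrow> state \<Rightarrow> bool" where
  "fresh l s \<longleftrightarrow> (\<forall>a\<ge>l * X. s aW a = 0)"

definition table :: "rat \<Rightarrow> nat set \<Rightarrow> nat \<Rightarrow> state \<Rightarrow> bool" where
  "table r P l s \<longleftrightarrow> table_sound r P l s \<and> table_complete r P l s \<and> fresh (Suc l) s"

lemma table_cong: "s' aW = s aW \<Longrightarrow> s' aM = s aM \<Longrightarrow> table r P l s' = table r P l s"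
  by (simp add: table_def table_sound_def table_complete_def fresh_def entry_def)

text \<open>The pairs (y', v') that precede (y, v) in the lexicographic order are those already
  treated by the nested loops, so the state at (y, n) is the state at (y + 1, 0).\<close>

definition progress :: "rat \<Rightarrow> nat \<Rightarrow> nat \<Rightarrow> nat \<Rightarrow> nat \<Rightarrow> state \<Rightarrow> bool" where
  "progress r p l y v s \<longleftrightarrow> (\<forall>y'<X. \<forall>v'<n. (y' < y \<or> y' = y \<and> v' < v) \<longrightarrow> 1 \<le> s aW (l * X + y') \<longrightarrow>
     good v' \<longrightarrow> d p v' \<le> r \<longrightarrow> 1 \<le> s aW (Suc l * X + (y' + code v')) \<and>
     s aW (Suc l * X + (y' + code v')) \<le> s aW (l * X + y') + w 0 v')"

text \<open>\<open>s0\<close> is the state in which the layer was begun; all layers up to l are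
  frozen at their contents there.\<close>

definition layer_inv :: "rat \<Rightarrow> nat set \<Rightarrow> nat \<Rightarrow> nat \<Rightarrow> state \<Rightarrow> nat \<Rightarrow> nat \<Rightarrow> state \<Rightarrow> bool" where
  "layer_inv r P p l s0 y v s \<longleftrightarrow> (\<forall>a<Suc l * X. s aW a = s0 aW a \<and> s aM a = s0 aM a) \<and>
     table_sound r (insert p P) (Suc l) s \<and> fresh (Suc (Suc l)) s \<and> progress r p l y v s"

lemma layer_inv_cong:
  "s' aW = s aW \<Longrightarrow> s' aM = s aM \<Longrightarrow> layer_inv r P p l s0 y v s' = layer_inv r P p l s0 y v s"
  by (simp add: layer_inv_def table_sound_def progress_def fresh_def entry_def)

lemma sum_w_nonneg: "S \<subseteq> {..<n} \<Longrightarrow> j < m \<Longrightarrow> 0 \<le> (\<Sum>v\<in>S. w j v)"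
  using w_nonneg by (intro sum_nonneg) auto

lemma set_mask_less_n: "S \<subseteq> {..<n} \<Longrightarrow> set_mask S < 2 ^ n"
  using set_mask_less[of S n] by (simp add: Int_absorb2)

lemma entry_old:
  assumes "table_sound r P l s0" "\<forall>a<Suc l * X. s aW a = s0 aW a \<and> s aM a = s0 aM a"
    "y < X" "1 \<le> s aW (l * X + y)"
  obtains S where "entry r P l s y S"
proof -
  have "l * X + y < Suc l * X" using assms by simp
  then have eq: "s aW (l * X + y) = s0 aW (l * X + y)" "s aM (l * X + y) = s0 aM (l * X + y)"
    using assms(2) by blast+
  then obtain S where "entry r P l s0 y S" using assms(1,3,4) unfolding table_sound_def by fastforce
  then have "entry r P l s y S" using eq by (simp add: entry_def)
  then show thesis by (rule that)
qed

text \<open>The write stays inside layer \<open>Suc l\<close> because the new code is below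
  \<open>X\<close>, so older layers and the fresh region survive. Earlier progress survives because
  a valid entry is only replaced by a lighter one, as \<open>better\<close> says.\<close>

lemma layer_inv_write:
  assumes inv: "layer_inv r P p l s0 y v s"
    and S: "S \<in> choices r (insert p P)" "(\<Sum>u\<in>S. code u) = y + code v"
      "(\<Sum>u\<in>S. w 0 u) + 1 = s aW (l * X + y) + w 0 v"
    and y: "y < X" and z: "y + code v < X"
    and better: "\<not> (1 \<le> s aW (Suc l * X + (y + code v)) \<and>
      s aW (Suc l * X + (y + code v)) \<le> 1 + (\<Sum>u\<in>S. w 0 u))"
  shows "layer_inv r P p l s0 y (Suc v)
    (s(aM := (s aM)(Suc l * X + (y + code v) := of_nat (set_mask S)),
       aW := (s aW)(Suc l * X + (y + code v) := 1 + (\<Sum>u\<in>S. w 0 u))))"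
    (is "layer_inv _ _ _ _ _ _ _ ?s")
proof -
  let ?z = "y + code v"
  have W: "?s aW = (s aW)(Suc l * X + ?z := 1 + (\<Sum>u\<in>S. w 0 u))"
    and M: "?s aM = (s aM)(Suc l * X + ?z := of_nat (set_mask S))" by simp_all
  have old: "?s aW (l * X + y') = s aW (l * X + y')" if "y' < X" for y'
  proof -
    have "l * X + y' \<noteq> Suc l * X + ?z" using that by simp
    then show ?thesis unfolding W by simp
  qed
  have "S \<subseteq> {..<n}" using choices_subset[OF S(1)] by auto
  then have one: "1 \<le> 1 + (\<Sum>u\<in>S. w 0 u)" using sum_w_nonneg[of S 0] m_pos by simp
  have "\<forall>a<Suc l * X. ?s aW a = s0 aW a \<and> ?s aM a = s0 aM a"
    using inv unfolding layer_inv_def by auto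
  moreover have "table_sound r (insert p P) (Suc l) ?s"
    unfolding table_sound_def
  proof (intro allI impI)
    fix y' assume y': "y' < X"
    show "?s aW (Suc l * X + y') = 0 \<or> (\<exists>S. entry r (insert p P) (Suc l) ?s y' S)"
    proof (cases "y' = ?z")
      case True
      then have "entry r (insert p P) (Suc l) ?s y' S" using S by (simp add: entry_def)
      then show ?thesis by blast
    next
      case False
      then have "?s aW (Suc l * X + y') = s aW (Suc l * X + y')" "?s aM (Suc l * X + y') = s aM (Suc l * X + y')"
        by simp_all
      moreover have "s aW (Suc l * X + y') = 0 \<or> (\<exists>S. entry r (insert p P) (Suc l) s y' S)"
        using inv y' unfolding layer_inv_def table_sound_def by blast
      ultimately show ?thesis unfolding entry_def by metis
    qed
  qed
  moreover have "fresh (Suc (Suc l)) ?s"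
    using inv z unfolding layer_inv_def fresh_def by auto
  moreover have "progress r p l y (Suc v) ?s"
    unfolding progress_def
  proof (intro allI impI)
    fix y' v' assume a: "y' < X" "v' < n" "y' < y \<or> y' = y \<and> v' < Suc v" "1 \<le> ?s aW (l * X + y')"
      "good v'" "d p v' \<le> r"
    show "1 \<le> ?s aW (Suc l * X + (y' + code v')) \<and>
       ?s aW (Suc l * X + (y' + code v')) \<le> ?s aW (l * X + y') + w 0 v'"
    proof (cases "y' = y \<and> v' = v")
      case True
      then show ?thesis using one old[OF a(1)] S(3) by (simp add: W)
    next
      case False
      then have "1 \<le> s aW (Suc l * X + (y' + code v')) \<and>
        s aW (Suc l * X + (y' + code v')) \<le> s aW (l * X + y') + w 0 v'"
        using inv a old[OF a(1)] unfolding layer_inv_def progress_def by (metis less_Suc_eq)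
      \<comment> \<open>If an earlier pair targets the same cell, the overwritten weight was valid
        and exceeded the new one, so the earlier bound persists.\<close>
      then show ?thesis using one old[OF a(1)] better
        by (cases "y' + code v' = ?z") (auto simp: W)
    qed
  qed
  ultimately show ?thesis unfolding layer_inv_def by blast
qed

lemma wp_improve:
  assumes inv: "layer_inv r P p l s0 y v s" and s0: "table_sound r P l s0"
    and s: "prepared s" "s vLay 0 = of_nat l" "s vY 0 = of_nat y" "s vV 0 = of_nat v"
      "s vP 0 = of_nat p" "s vR 0 = r" "y < X" "v < n" "1 \<le> s aW (l * X + y)"
    and P: "p < n" "P \<subseteq> {..<n}" "p \<notin> P" "\<And>u. u \<in> P \<Longrightarrow> 2 * r < d p u"
  shows "wp B improve s (layer_inv r P p l s0 y (Suc v))"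
proof -
  have s': "s 0 = A" "s vX 0 = of_nat X" "s aCode v = of_nat (code v)" "s aPow v = of_nat (2 ^ v)"
    "s aGood v = (if good v then 1 else 0)"
    using s unfolding prepared_def by auto
  have dist: "aval (Entry (Var vP) (Var vV)) s = d p v"
    using s s' P by (intro aval_dist) simp_all
  have old: "aval old_pos t = of_nat (l * X + y)" if "\<forall>a. a \<notin> {aM} \<longrightarrow> t a = s a" for t
    using s s' that by (simp add: old_pos_def)
  have new: "aval new_pos t = of_nat (Suc l * X + (y + code v))" if "\<forall>a. a \<notin> {aM} \<longrightarrow> t a = s a" for t
    using s s' that by (simp add: new_pos_def algebra_simps)
  have skip: "layer_inv r P p l s0 y (Suc v) s"
    if "good v \<Longrightarrow> d p v \<le> r \<Longrightarrow> 1 \<le> s aW (Suc l * X + (y + code v)) \<and>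
       s aW (Suc l * X + (y + code v)) \<le> s aW (l * X + y) + w 0 v"
    using inv that unfolding layer_inv_def progress_def by (auto simp: less_Suc_eq)
  show ?thesis
    unfolding improve_def
  proof (rule wp_Cond)
    assume "bval (Conj (Leq (Const 1) (Read aGood (Var vV))) (Leq (Entry (Var vP) (Var vV)) (Var vR))) s"
    then have gd: "good v" "d p v \<le> r" using dist s s' by (auto split: if_splits)
    obtain S where S: "entry r P l s y S"
      using entry_old[of r P l s0 s y] s0 s(7,9) inv unfolding layer_inv_def by blast
    have ch: "S \<in> choices r P" using S by (simp add: entry_def)
    \<comment> \<open>Disjointness of the balls enters here and makes code, weight and mask additive
      below.\<close>
    have nin: "v \<notin> S" using choices_fresh[of p P r S v] P ch gd s by auto
    have fin: "finite S" using choices_finite ch by blast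
    have ch': "insert v S \<in> choices r (insert p P)" using choices_insertI P ch gd s by blast
    have sub: "insert v S \<subseteq> {..<n}" using choices_subset[OF ch'] by auto
    have cd: "(\<Sum>u\<in>insert v S. code u) = y + code v" using S nin fin by (simp add: entry_def)
    \<comment> \<open>The sum is the code of a set of points, hence it does not overflow into the
      next layer.\<close>
    have z: "y + code v < X" using sum_code_less[OF sub] cd by simp
    have wt: "(\<Sum>u\<in>insert v S. w 0 u) + 1 = s aW (l * X + y) + w 0 v"
      using S nin fin by (simp add: entry_def)
    have mk: "s aM (l * X + y) + of_nat (2 ^ v) = of_nat (set_mask (insert v S))"
      using S nin fin by (simp add: entry_def set_mask_insert)
    have new_weight: "aval new_weight t = 1 + (\<Sum>u\<in>insert v S. w 0 u)" if t: "\<forall>a. a \<notin> {aM} \<longrightarrow> t a = s a" for t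
    proof -
      have "aval (weight_entry (Const 0) (Var vV)) t = w 0 v"
        using s s' t m_pos by (intro aval_weight) simp_all
      moreover have "aval (Read aW old_pos) t = s aW (l * X + y)"
        unfolding aval_Read[OF old[OF t]] using t by simp
      ultimately show ?thesis using wt by (simp add: new_weight_def)
    qed
    have nw: "aval new_weight s = 1 + (\<Sum>u\<in>insert v S. w 0 u)" by (rule new_weight) simp
    have Wnew: "aval (Read aW new_pos) s = s aW (Suc l * X + (y + code v))"
      by (rule aval_Read) (simp add: new)
    show "wp B (Cond (Conj (Leq (Const 1) (Read aW new_pos)) (Leq (Read aW new_pos) new_weight)) Skip
          (Assign aM new_pos (Add (Read aM old_pos) (Read aPow (Var vV))) ;;
           Assign aW new_pos new_weight)) s (layer_inv r P p l s0 y (Suc v))"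
    proof (rule wp_Cond)
      assume "bval (Conj (Leq (Const 1) (Read aW new_pos)) (Leq (Read aW new_pos) new_weight)) s"
      then show "wp B Skip s (layer_inv r P p l s0 y (Suc v))"
        using Wnew nw wt unfolding bval.simps aval.simps(1)
        by (intro wp_Skip skip) linarith
    next
      assume nb: "\<not> bval (Conj (Leq (Const 1) (Read aW new_pos)) (Leq (Read aW new_pos) new_weight)) s"
      let ?s = "s(aM := (s aM)(Suc l * X + (y + code v) := of_nat (set_mask (insert v S))))"
      have fr: "\<forall>a. a \<notin> {aM} \<longrightarrow> ?s a = s a" by simp
      show "wp B (Assign aM new_pos (Add (Read aM old_pos) (Read aPow (Var vV))) ;;
           Assign aW new_pos new_weight) s (layer_inv r P p l s0 y (Suc v))"
      proof (rule wp_Assign_Seq[where k = "Suc l * X + (y + code v)"])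
        show "aval new_pos s = of_nat (Suc l * X + (y + code v))" using new by simp
        have "aval (Read aM old_pos) s = s aM (l * X + y)" by (rule aval_Read) (simp add: old)
        then show "aval (Add (Read aM old_pos) (Read aPow (Var vV))) s = of_nat (set_mask (insert v S))"
          using mk s s' unfolding aval.simps(3) by simp
        show "rat_size (of_nat (set_mask (insert v S))) \<le> B"
          using set_mask_less_n[OF sub] by (intro size_power) simp
        show "wp B (Assign aW new_pos new_weight) ?s (layer_inv r P p l s0 y (Suc v))"
        proof (rule wp_AssignI[where k = "Suc l * X + (y + code v)"])
          show "aval new_pos ?s = of_nat (Suc l * X + (y + code v))" using new[OF fr] .
          show "aval new_weight ?s = 1 + (\<Sum>u\<in>insert v S. w 0 u)" using new_weight[OF fr] .
          show "rat_size (1 + (\<Sum>u\<in>insert v S. w 0 u)) \<le> B" using B_sum1[OF sub] .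
          have "\<not> (1 \<le> s aW (Suc l * X + (y + code v)) \<and>
            s aW (Suc l * X + (y + code v)) \<le> 1 + (\<Sum>u\<in>insert v S. w 0 u))"
            using nb Wnew nw unfolding bval.simps aval.simps(1) by simp
          moreover have "?s aW = s aW" by simp
          ultimately show "layer_inv r P p l s0 y (Suc v)
             (?s(aW := (?s aW)(Suc l * X + (y + code v) := 1 + (\<Sum>u\<in>insert v S. w 0 u))))"
            using layer_inv_write[OF inv ch' cd wt s(7) z] by metis
        qed
      qed
    qed
  next
    assume "\<not> bval (Conj (Leq (Const 1) (Read aGood (Var vV))) (Leq (Entry (Var vP) (Var vV)) (Var vR))) s"
    then have "\<not> (good v \<and> d p v \<le> r)" using dist s s' by (auto split: if_splits)
    then show "wp B Skip s (layer_inv r P p l s0 y (Suc v))" by (intro wp_Skip skip) auto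
  qed
qed

lemma written_improve[simp]: "written improve = {aM, aW}"
  by (auto simp: improve_def)

lemma written_next_layer[simp]: "written next_layer = {vY, vV, aM, aW}"
  by (auto simp: next_layer_def)

lemma wp_next_layer:
  assumes s: "prepared s" "s vLay 0 = of_nat l" "s vP 0 = of_nat p" "s vR 0 = r" "table r P l s"
    and P: "p < n" "P \<subseteq> {..<n}" "p \<notin> P" "\<And>u. u \<in> P \<Longrightarrow> 2 * r < d p u"
  shows "wp B next_layer s (table r (insert p P) (Suc l))"
  unfolding next_layer_def
proof (rule wp_For[where I = "\<lambda>y. layer_inv r P p l s y 0" and k = X])
  let ?body = "Cond (Leq (Const 1) (Read aW old_pos)) (For vV (Var 0) improve) Skip"
  have snd: "table_sound r P l s" and cpl: "table_complete r P l s" and fr: "fresh (Suc l) s"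
    using s unfolding table_def by auto
  have "fresh (Suc (Suc l)) s" using fr by (simp add: fresh_def)
  moreover have "table_sound r (insert p P) (Suc l) s" using fr by (simp add: fresh_def table_sound_def)
  ultimately have "layer_inv r P p l s 0 0 s" by (simp add: layer_inv_def progress_def)
  then show "layer_inv r P p l s 0 0 (s(vY := (s vY)(0 := x)))" for x
    by (subst layer_inv_cong[of _ s]) simp_all
  show "X + 2 \<le> B" using B_X by simp
  show "layer_inv r P p l s i 0 (t(vY := (t vY)(0 := x)))" if "layer_inv r P p l s i 0 t" for i t x
    using that by (subst layer_inv_cong[of _ t]) simp_all
  show "aval (Var vX) t = of_nat X" if "\<forall>a. a \<notin> insert vY (written ?body) \<longrightarrow> t a = s a" for t
    using that s by (simp add: prepared_def)
  show "table r (insert p P) (Suc l) t" if t: "layer_inv r P p l s X 0 t" for t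
    unfolding table_def
  proof (intro conjI)
    show "table_sound r (insert p P) (Suc l) t" "fresh (Suc (Suc l)) t"
      using t by (auto simp: layer_inv_def)
    show "table_complete r (insert p P) (Suc l) t"
      unfolding table_complete_def
    proof
      fix S assume "S \<in> choices r (insert p P)"
      \<comment> \<open>Bellman's principle: the cell for the code of T in layer l is no heavier
        than T, and extending its choice by v gives the code of S at no greater weight.\<close>
      then obtain T v where T: "T \<in> choices r P" "v < n" "good v" "d p v \<le> r" "S = insert v T"
        by (rule choices_insertE)
      let ?y = "\<Sum>u\<in>T. code u"
      have y: "?y < X" using choices_subset[OF T(1)] by (intro sum_code_less) auto
      have fin: "finite T" using choices_finite T by blast
      have nin: "v \<notin> T" using choices_fresh[of p P r T v] P T by auto
      have "l * X + ?y < Suc l * X" using y by simp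
      then have "t aW (l * X + ?y) = s aW (l * X + ?y)" using t unfolding layer_inv_def by blast
      then have "1 \<le> t aW (l * X + ?y)" "t aW (l * X + ?y) \<le> 1 + (\<Sum>u\<in>T. w 0 u)"
        using cpl T by (auto simp: table_complete_def)
      moreover have "1 \<le> t aW (Suc l * X + (?y + code v)) \<and>
        t aW (Suc l * X + (?y + code v)) \<le> t aW (l * X + ?y) + w 0 v"
        using t y T calculation unfolding layer_inv_def progress_def by blast
      moreover have "(\<Sum>u\<in>S. code u) = ?y + code v" "(\<Sum>u\<in>S. w 0 u) = (\<Sum>u\<in>T. w 0 u) + w 0 v"
        using T fin nin by auto
      ultimately show "1 \<le> t aW (Suc l * X + (\<Sum>u\<in>S. code u)) \<and>
        t aW (Suc l * X + (\<Sum>u\<in>S. code u)) \<le> 1 + (\<Sum>u\<in>S. w 0 u)" by simp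
    qed
  qed
  fix y t assume y: "y < X" and t: "layer_inv r P p l s y 0 t"
    "\<forall>a. a \<notin> insert vY (written ?body) \<longrightarrow> t a = s a" "t vY 0 = of_nat y"
  have t': "t vLay 0 = of_nat l" "t vX 0 = of_nat X" using t(2) s by (simp_all add: prepared_def)
  have old: "aval (Read aW old_pos) t = t aW (l * X + y)"
    by (rule aval_Read) (simp add: old_pos_def t' t(3))
  have next_y: "layer_inv r P p l s (Suc y) 0 t'" if "layer_inv r P p l s y n t'" for t'
    using that by (auto simp: layer_inv_def progress_def less_Suc_eq)
  show "wp B ?body t (layer_inv r P p l s (Suc y) 0)"
  proof (rule wp_Cond)
    assume "bval (Leq (Const 1) (Read aW old_pos)) t"
    then have valid: "1 \<le> t aW (l * X + y)" using old by simp
    show "wp B (For vV (Var 0) improve) t (layer_inv r P p l s (Suc y) 0)"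
    proof (rule wp_For[where I = "layer_inv r P p l s y" and k = n])
      show "n + 2 \<le> B" using B_n by simp
      show "layer_inv r P p l s y 0 (t(vV := (t vV)(0 := x)))" for x
        using t(1) by (subst layer_inv_cong[of _ t]) simp_all
      show "layer_inv r P p l s y i (t(vV := (t vV)(0 := x)))" if "layer_inv r P p l s y i t" for i t x
        using that by (subst layer_inv_cong[of _ t]) simp_all
      show "aval (Var 0) t' = of_nat n" if "\<forall>a. a \<notin> insert vV (written improve) \<longrightarrow> t' a = t a" for t'
        using that t(2) s(1) A_0 by (simp add: prepared_def)
      fix v t' assume v: "v < n" "layer_inv r P p l s y v t'"
        "\<forall>a. a \<notin> insert vV (written improve) \<longrightarrow> t' a = t a" "t' vV 0 = of_nat v"
      have fr: "\<forall>a. a \<notin> {vY, vV, aM, aW} \<longrightarrow> t' a = s a" using v(3) t(2) by simp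
      have "prepared t'" by (rule prepared_cong[OF s(1) fr]) simp
      moreover have "t' vLay 0 = of_nat l" "t' vP 0 = of_nat p" "t' vR 0 = r" using fr s by simp_all
      moreover have "t' vY 0 = of_nat y" using v(3) t(3) by simp
      moreover have "1 \<le> t' aW (l * X + y)"
      proof -
        have "l * X + y < Suc l * X" using y by simp
        then have "t' aW (l * X + y) = t aW (l * X + y)"
          using v(2) t(1) unfolding layer_inv_def by metis
        then show ?thesis using valid by simp
      qed
      ultimately show "wp B improve t' (layer_inv r P p l s y (Suc v))"
        using v y P snd by (intro wp_improve) auto
    qed (simp_all add: next_y)
  next
    assume "\<not> bval (Leq (Const 1) (Read aW old_pos)) t"
    then have "\<not> 1 \<le> t aW (l * X + y)" using old by simp
    then show "wp B Skip t (layer_inv r P p l s (Suc y) 0)"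
      using t(1) by (intro wp_Skip) (auto simp: layer_inv_def progress_def less_Suc_eq)
  qed
qed simp_all

section \<open>Pivots and the growth of the table\<close>

lemma written_pivot_step[simp]:
  "written pivot_step = {vPiv, vU, aPiv, vY, vV, aM, aW, vLay}"
  by (auto simp: pivot_step_def)

text \<open>Points that do not become pivots add no layer, so the layer number is only bounded by l
  + p.\<close>

definition pivot_inv :: "rat \<Rightarrow> nat \<Rightarrow> nat \<Rightarrow> state \<Rightarrow> bool" where
  "pivot_inv r l p s \<longleftrightarrow> (\<exists>l'\<le>l + p. s vLay 0 = of_nat l' \<and> table r (pivots r p) l' s) \<and>
     (\<forall>u<p. s aPiv u = (if u \<in> pivots r p then 1 else 0))"

lemma wp_pivot_step:
  assumes s: "prepared s" "s vP 0 = of_nat p" "s vR 0 = r" "pivot_inv r l p s"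
    and p: "p < n" and l: "l + n + 3 \<le> B"
  shows "wp B pivot_step s (pivot_inv r l (Suc p))"
  unfolding pivot_step_def
proof (rule wp_Assign_Seq[where k = 0 and x = 1])
  \<comment> \<open>At u = p this is the condition for p to become a pivot; for smaller u it is what
    the inner loop has established so far.\<close>
  define far where "far u \<longleftrightarrow> (\<forall>u'\<in>pivots r p. u' < u \<longrightarrow> \<not> d p u' \<le> 2 * r)" for u
  let ?c = "Cond (Conj (Leq (Const 1) (Read aPiv (Var vU)))
      (Leq (Entry (Var vP) (Var vU)) (Mul (Const 2) (Var vR)))) (Set vPiv (Const 0)) Skip"
  let ?s = "s(vPiv := (s vPiv)(0 := 1))"
  obtain l' where l': "l' \<le> l + p" "s vLay 0 = of_nat l'" "table r (pivots r p) l' s"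
    and piv: "\<And>u. u < p \<Longrightarrow> s aPiv u = (if u \<in> pivots r p then 1 else 0)"
    using s unfolding pivot_inv_def by blast
  have sA: "s 0 = A" using s by (simp add: prepared_def)
  have pl: "u < p" if "u \<in> pivots r p" for u using that pivots_less by auto
  have "wp B (For vU (Var vP) ?c) ?s (\<lambda>t. t vPiv 0 = (if far p then 1 else 0))"
  proof (rule wp_For[where I = "\<lambda>u t. t vPiv 0 = (if far u then 1 else 0)" and k = p])
    show "p + 2 \<le> B" using l p by simp
    fix u t assume u: "u < p" "t vPiv 0 = (if far u then 1 else 0)"
      "\<forall>a. a \<notin> insert vU (written ?c) \<longrightarrow> t a = ?s a" "t vU 0 = of_nat u"
    then have t: "t 0 = A" "t vP 0 = of_nat p" "t vR 0 = r" "t aPiv = s aPiv" using s sA by simp_all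
    have dist: "aval (Entry (Var vP) (Var vU)) t = d p u"
      using t u p by (intro aval_dist) simp_all
    have far: "far (Suc u) \<longleftrightarrow> far u \<and> \<not> (u \<in> pivots r p \<and> d p u \<le> 2 * r)"
      by (auto simp: far_def less_Suc_eq)
    have "bval (Conj (Leq (Const 1) (Read aPiv (Var vU)))
      (Leq (Entry (Var vP) (Var vU)) (Mul (Const 2) (Var vR)))) t \<longleftrightarrow> u \<in> pivots r p \<and> d p u \<le> 2 * r"
      using dist t u piv by simp
    then show "wp B ?c t (\<lambda>t. t vPiv 0 = (if far (Suc u) then 1 else 0))"
      using u(2) far by (intro wp_Cond wp_Skip wp_Set[where x = 0]) simp_all
  qed (use s in \<open>simp_all add: far_def\<close>)
  then show "wp B (For vU (Var vP) ?c ;; Assign aPiv (Var vP) (Var vPiv) ;;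
     Cond (Leq (Const 1) (Var vPiv)) (next_layer ;; Set vLay (Add (Var vLay) (Const 1))) Skip) ?s
     (pivot_inv r l (Suc p))"
  proof (rule wp_SeqI)
    fix t assume "\<forall>a. a \<notin> written (For vU (Var vP) ?c) \<longrightarrow> t a = ?s a"
      and tp: "t vPiv 0 = (if far p then 1 else 0)"
    then have fr: "\<forall>a. a \<notin> {vU, vPiv} \<longrightarrow> t a = s a" by simp
    define b :: rat where "b = (if far p then 1 else 0)"
    define t1 where "t1 = t(aPiv := (t aPiv)(p := b))"
    have fr1: "\<forall>a. a \<notin> {vU, vPiv, aPiv} \<longrightarrow> t1 a = s a" using fr by (simp add: t1_def)
    have t1: "prepared t1" "t1 vLay 0 = of_nat l'" "t1 vP 0 = of_nat p" "t1 vR 0 = r"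
      "table r (pivots r p) l' t1"
      using prepared_cong[OF s(1) fr1] fr1 s l' by (simp_all add: table_cong[of t1 s])
    have t1b: "t1 vPiv 0 = b" using tp by (simp add: t1_def b_def)
    have t1p: "t1 aPiv u = (if u \<in> pivots r (Suc p) then 1 else 0)" if "u < Suc p" for u
    proof (cases "u = p")
      case True
      then show ?thesis using pl by (auto simp: t1_def b_def far_def)
    next
      case False
      then have "t1 aPiv u = s aPiv u" using fr by (simp add: t1_def)
      then show ?thesis using piv False that by auto
    qed
    have cond: "wp B (Cond (Leq (Const 1) (Var vPiv)) (next_layer ;; Set vLay (Add (Var vLay) (Const 1))) Skip) t1
      (pivot_inv r l (Suc p))"
    proof (rule wp_Cond)
      assume "bval (Leq (Const 1) (Var vPiv)) t1"
      then have "far p" using t1b by (simp add: b_def split: if_splits)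
      then have far: "\<And>u. u \<in> pivots r p \<Longrightarrow> 2 * r < d p u" using pl by (auto simp: far_def not_le)
      then have pv: "pivots r (Suc p) = insert p (pivots r p)" by force
      have "wp B next_layer t1 (table r (pivots r (Suc p)) (Suc l'))"
        unfolding pv using t1 p pl far by (intro wp_next_layer) (auto intro: less_trans)
      then show "wp B (next_layer ;; Set vLay (Add (Var vLay) (Const 1))) t1 (pivot_inv r l (Suc p))"
      proof (rule wp_SeqI)
        fix t2 assume t2: "\<forall>a. a \<notin> written next_layer \<longrightarrow> t2 a = t1 a" "table r (pivots r (Suc p)) (Suc l') t2"
        have "rat_size (of_nat (Suc l')) \<le> B" using l' l p by (intro size_of_nat) simp
        moreover have "t2 vLay 0 = of_nat l'" "t2 aPiv = t1 aPiv" using t2 t1 by simp_all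
        moreover have "pivot_inv r l (Suc p) (t2(vLay := (t2 vLay)(0 := of_nat (Suc l'))))"
          unfolding pivot_inv_def
        proof (intro conjI exI[of _ "Suc l'"])
          show "\<forall>u<Suc p. (t2(vLay := (t2 vLay)(0 := of_nat (Suc l')))) aPiv u =
            (if u \<in> pivots r (Suc p) then 1 else 0)"
            using t1p t2(1) by simp
          show "table r (pivots r (Suc p)) (Suc l') (t2(vLay := (t2 vLay)(0 := of_nat (Suc l'))))"
            using t2(2) by (subst table_cong[of _ t2]) simp_all
        qed (use l' in simp_all)
        ultimately show "wp B (Set vLay (Add (Var vLay) (Const 1))) t2 (pivot_inv r l (Suc p))"
          by (intro wp_Set[where x = "of_nat (Suc l')"]) simp_all
      qed
    next
      assume "\<not> bval (Leq (Const 1) (Var vPiv)) t1"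
      then have "\<not> far p" using t1b by (simp add: b_def split: if_splits)
      then have pv: "pivots r (Suc p) = pivots r p" by (auto simp: far_def)
      have "pivot_inv r l (Suc p) t1"
        unfolding pivot_inv_def
      proof (intro conjI exI[of _ l'])
        show "table r (pivots r (Suc p)) l' t1" using t1 pv by simp
      qed (use t1 t1p l' in auto)
      then show "wp B Skip t1 (pivot_inv r l (Suc p))" by (rule wp_Skip)
    qed
    have "rat_size b \<le> B" by (simp add: b_def)
    then show "wp B (Assign aPiv (Var vP) (Var vPiv) ;;
      Cond (Leq (Const 1) (Var vPiv)) (next_layer ;; Set vLay (Add (Var vLay) (Const 1))) Skip) t (pivot_inv r l (Suc p))"
      using cond[unfolded t1_def] fr s tp
      by (intro wp_Assign_Seq[where k = p and x = b]) (simp_all add: b_def)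
  qed
qed simp_all

lemma wp_first_layer:
  assumes s: "prepared s" "s vLay 0 = of_nat l" "fresh (Suc l) s" and l: "l + 3 \<le> B"
  shows "wp B first_layer s (pivot_inv r (Suc l) 0)"
proof -
  let ?s = "s(vLay := (s vLay)(0 := of_nat (Suc l)), aW := (s aW)(Suc l * X := 1), aM := (s aM)(Suc l * X := 0))"
  have X: "0 < X" by (simp add: base_def)
  have "table r {} (Suc l) ?s"
    unfolding table_def
  proof (intro conjI)
    have "entry r {} (Suc l) ?s 0 {}" by (simp add: entry_def choices_empty set_mask_def)
    then show "table_sound r {} (Suc l) ?s"
      using s(3) unfolding table_sound_def fresh_def by (auto intro: neq0_conv[THEN iffD1])
    show "table_complete r {} (Suc l) ?s" by (simp add: table_complete_def choices_empty)
    show "fresh (Suc (Suc l)) ?s" using s(3) X by (auto simp: fresh_def)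
  qed
  then have "pivot_inv r (Suc l) 0 ?s" by (auto simp: pivot_inv_def)
  moreover have "s vX 0 = of_nat X" using s by (simp add: prepared_def)
  moreover have "rat_size (of_nat (Suc l)) \<le> B" using l by (intro size_of_nat) simp
  ultimately show ?thesis unfolding first_layer_def using s(2)
    by (intro wp_Assign_Seq[where a = vLay and k = 0 and x = "of_nat (Suc l)"]
        wp_Assign_Seq[where a = aW and k = "Suc l * X" and x = 1] wp_AssignI[where k = "Suc l * X" and x = 0])
      (simp_all add: distrib_right)
qed

section \<open>Decoding a mask and testing the budgets\<close>

lemma written_decode[simp]: "written decode = {vV, 1, vMk}"
  by (auto simp: decode_def)

lemma written_check[simp]: "written (check m N) = {vV, 1, vMk, vOk, vJ, vSum}"
  by (auto simp: check_def)

text \<open>When bit k is examined, only bits up to k are left. The lower ones sum to less than 2 ^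
  k, so comparison with 2 ^ k reveals bit k.\<close>

lemma wp_decode:
  assumes s: "prepared s" "s vMk 0 = of_nat (set_mask S)" and S: "S \<subseteq> {..<n}"
  shows "wp B decode s (\<lambda>s'. \<forall>v<n. s' 1 v = (if v \<in> S then 1 else 0))"
  unfolding decode_def
proof (rule wp_For[where k = n and I = "\<lambda>i t. t vMk 0 = of_nat (set_mask (S \<inter> {..<n - i})) \<and>
    (\<forall>v<n. n - i \<le> v \<longrightarrow> t 1 v = (if v \<in> S then 1 else 0))"], goal_cases)
  case (5 i t)
  then show ?case using s A_0 by (simp add: prepared_def)
next
  case (6 i t)
  define k where "k = n - Suc i"
  have k: "k < n" "n - i = Suc k" "of_nat k = of_nat n - 1 - (of_nat i :: rat)"
    using 6(1) by (simp_all add: k_def of_nat_diff)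
  have top: "aval top_pos t' = of_nat k" if "t' 0 = t 0" "t' vV 0 = t vV 0" for t'
    using 6 s A_0 k that by (simp add: top_pos_def prepared_def)
  have pow: "aval (Read aPow top_pos) t' = of_nat (2 ^ k)"
    if "t' 0 = t 0" "t' vV 0 = t vV 0" "t' aPow = t aPow" for t'
    unfolding aval_Read[OF top[OF that(1,2)]] using 6 s k that by (simp add: prepared_def)
  have mk: "t vMk 0 = of_nat (set_mask (S \<inter> {..<k}) + (if k \<in> S then 2 ^ k else 0))"
    using 6(2) unfolding k(2) set_mask_Suc by simp
  have small: "set_mask (S \<inter> {..<k}) < 2 ^ k" by (rule set_mask_less)
  have "set_mask (S \<inter> {..<k}) \<le> 2 ^ n"
    using set_mask_less_n[of "S \<inter> {..<k}"] S by (simp add: le_infI1)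
  then have size: "rat_size (of_nat (set_mask (S \<inter> {..<k}))) \<le> B" by (rule size_power)
  have out: "t 1 v = (if v \<in> S then 1 else 0)" if "v < n" "k \<le> v" "v \<noteq> k" for v
    using 6(2) that k by simp
  have bv: "bval (Leq (Read aPow top_pos) (Var vMk)) t \<longleftrightarrow> k \<in> S"
  proof -
    have "bval (Leq (Read aPow top_pos) (Var vMk)) t \<longleftrightarrow>
      2 ^ k \<le> set_mask (S \<inter> {..<k}) + (if k \<in> S then 2 ^ k else 0)"
      unfolding bval.simps pow[of t, OF refl refl refl] using mk
      by (simp only: aval.simps address_0 of_nat_le_iff)
    then show ?thesis using small by auto
  qed
  show ?case unfolding k_def[symmetric]
  proof (rule wp_Cond)
    assume "bval (Leq (Read aPow top_pos) (Var vMk)) t"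
    then have "k \<in> S" using bv by simp
    then have mk': "t vMk 0 = of_nat (set_mask (S \<inter> {..<k})) + of_nat (2 ^ k)" using mk by simp
    show "wp B (Assign 1 top_pos (Const 1) ;; Set vMk (Sub (Var vMk) (Read aPow top_pos))) t
      (\<lambda>t. t vMk 0 = of_nat (set_mask (S \<inter> {..<k})) \<and> (\<forall>v<n. k \<le> v \<longrightarrow> t 1 v = (if v \<in> S then 1 else 0)))"
    proof (rule wp_Assign_Seq[where k = k and x = 1])
      let ?t = "t(1 := (t 1)(k := 1))"
      show "wp B (Set vMk (Sub (Var vMk) (Read aPow top_pos))) ?t
        (\<lambda>t. t vMk 0 = of_nat (set_mask (S \<inter> {..<k})) \<and> (\<forall>v<n. k \<le> v \<longrightarrow> t 1 v = (if v \<in> S then 1 else 0)))"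
      proof (rule wp_Set[where x = "of_nat (set_mask (S \<inter> {..<k}))"])
        show "aval (Sub (Var vMk) (Read aPow top_pos)) ?t = of_nat (set_mask (S \<inter> {..<k}))"
          unfolding aval.simps(4) using mk' by (subst pow) simp_all
      qed (use size out \<open>k \<in> S\<close> in auto)
    qed (simp_all add: top)
  next
    assume "\<not> bval (Leq (Read aPow top_pos) (Var vMk)) t"
    then have "k \<notin> S" using bv by simp
    then show "wp B (Assign 1 top_pos (Const 0)) t
      (\<lambda>t. t vMk 0 = of_nat (set_mask (S \<inter> {..<k})) \<and> (\<forall>v<n. k \<le> v \<longrightarrow> t 1 v = (if v \<in> S then 1 else 0)))"
      using mk out by (intro wp_AssignI[where k = k and x = 0]) (auto simp: top)
  qed
qed (use s S B_n in \<open>simp_all add: Int_absorb2\<close>)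

definition within_limits :: "nat set \<Rightarrow> nat \<Rightarrow> bool" where
  "within_limits S k \<longleftrightarrow> (\<forall>j<k. (\<Sum>v\<in>S. w j v) \<le> (1 + 1 / of_nat N) * L j)"

lemma wp_check:
  assumes s: "prepared s" "s vMk 0 = of_nat (set_mask S)" and S: "S \<subseteq> {..<n}"
  shows "wp B (check m N) s (\<lambda>s'. s' vOk 0 = (if within_limits S m then 1 else 0))"
  unfolding check_def
proof (rule wp_SeqI[OF wp_decode[OF s S]], rule wp_Assign_Seq[where k = 0 and x = 1])
  fix s1 assume s1: "\<forall>a. a \<notin> written decode \<longrightarrow> s1 a = s a"
    and out: "\<forall>v<n. s1 1 v = (if v \<in> S then 1 else 0)"
  let ?sum = "For vV (Var 0)
    (Set vSum (Add (Var vSum) (Mul (Read 1 (Var vV)) (weight_entry (Var vJ) (Var vV)))))"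
  let ?cond = "Cond (Leq (Var vSum) (Mul (Const (1 + 1 / of_nat N)) (budget_entry m (Var vJ))))
          Skip (Set vOk (Const 0))"
  let ?s = "s1(vOk := (s1 vOk)(0 := 1))"
  have s10: "s1 0 = A" using s1 s by (simp add: prepared_def)
  show "wp B (For vJ (Const (of_nat m)) (Set vSum (Const 0) ;; ?sum ;; ?cond)) ?s
    (\<lambda>s'. s' vOk 0 = (if within_limits S m then 1 else 0))"
  proof (rule wp_For[where I = "\<lambda>j t. t vOk 0 = (if within_limits S j then 1 else 0)" and k = m])
    fix j t assume j: "j < m" and t: "t vOk 0 = (if within_limits S j then 1 else 0)"
      "\<forall>a. a \<notin> insert vJ (written (Set vSum (Const 0) ;; ?sum ;; ?cond)) \<longrightarrow> t a = ?s a"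
      "t vJ 0 = of_nat j"
    let ?t = "t(vSum := (t vSum)(0 := 0))"
    have t': "?t 0 = A" "?t 1 = s1 1" "?t vJ 0 = of_nat j" "?t vOk 0 = t vOk 0"
      using s10 t(2,3) by simp_all
    have "wp B ?sum ?t (\<lambda>t'. t' vSum 0 = (\<Sum>u\<in>S. w j u))"
    proof (rule wp_For[where I = "\<lambda>v t'. t' vSum 0 = (\<Sum>u\<in>S \<inter> {..<v}. w j u)" and k = n])
      fix v t' assume v: "v < n" "t' vSum 0 = (\<Sum>u\<in>S \<inter> {..<v}. w j u)" "t' vV 0 = of_nat v"
        "\<forall>a. a \<notin> insert vV (written (Set vSum (Add (Var vSum) (Mul (Read 1 (Var vV))
           (weight_entry (Var vJ) (Var vV)))))) \<longrightarrow> t' a = ?t a"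
      have t'': "t' 0 = A" "t' 1 = s1 1" "t' vJ 0 = of_nat j" using v(4) t' by simp_all
      have W: "aval (weight_entry (Var vJ) (Var vV)) t' = w j v"
        using t'' v j by (intro aval_weight) simp_all
      have "S \<inter> {..<Suc v} = (if v \<in> S then insert v (S \<inter> {..<v}) else S \<inter> {..<v})"
        by (auto simp: less_Suc_eq)
      then have "(\<Sum>u\<in>S \<inter> {..<Suc v}. w j u) = (\<Sum>u\<in>S \<inter> {..<v}. w j u) + (if v \<in> S then 1 else 0) * w j v"
        by simp
      moreover have "rat_size (\<Sum>u\<in>S \<inter> {..<Suc v}. w j u) \<le> B"
        using S by (intro B_sum j) auto
      ultimately show "wp B (Set vSum (Add (Var vSum) (Mul (Read 1 (Var vV)) (weight_entry (Var vJ) (Var vV)))))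
        t' (\<lambda>t'. t' vSum 0 = (\<Sum>u\<in>S \<inter> {..<Suc v}. w j u))"
        using v t'' W out by (intro wp_Set[where x = "\<Sum>u\<in>S \<inter> {..<Suc v}. w j u"]) simp_all
    next
      show "aval (Var 0) t' = of_nat n" if "\<forall>a. a \<notin> insert vV (written (Set vSum (Add (Var vSum)
        (Mul (Read 1 (Var vV)) (weight_entry (Var vJ) (Var vV)))))) \<longrightarrow> t' a = ?t a" for t'
        using that t'(1) A_0 by simp
    qed (use B_n S in \<open>simp_all add: Int_absorb2\<close>)
    then have "wp B (?sum ;; ?cond) ?t (\<lambda>t. t vOk 0 = (if within_limits S (Suc j) then 1 else 0))"
    proof (rule wp_SeqI)
      fix u assume u: "\<forall>a. a \<notin> written ?sum \<longrightarrow> u a = ?t a" "u vSum 0 = (\<Sum>v\<in>S. w j v)"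
      have u': "u 0 = A" "u vJ 0 = of_nat j" "u vOk 0 = t vOk 0" using u(1) t' by simp_all
      have L: "aval (budget_entry m (Var vJ)) u = L j" using u' j by (intro aval_budget) simp_all
      have "within_limits S (Suc j) \<longleftrightarrow> within_limits S j \<and> (\<Sum>v\<in>S. w j v) \<le> (1 + 1 / of_nat N) * L j"
        by (auto simp: within_limits_def less_Suc_eq)
      then show "wp B ?cond u (\<lambda>t. t vOk 0 = (if within_limits S (Suc j) then 1 else 0))"
        using L u(2) u'(3) t(1) by (intro wp_Cond wp_Skip wp_Set[where x = 0]) simp_all
    qed
    then show "wp B (Set vSum (Const 0) ;; ?sum ;; ?cond) t
      (\<lambda>t. t vOk 0 = (if within_limits S (Suc j) then 1 else 0))"
      by (intro wp_Assign_Seq[where k = 0 and x = 0]) simp_all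
  qed (use B_m in \<open>simp_all add: within_limits_def\<close>)
qed simp_all

text \<open>Anything ever stored is admissible and within three times its recorded radius. How good
  that radius is remains the business of \<open>beats\<close>.\<close>

definition result :: "state \<Rightarrow> bool" where
  "result s \<longleftrightarrow> s vFound 0 = 0 \<and> s vBMask 0 = 0 \<or>
     s vFound 0 = 1 \<and> (\<exists>S. admissible S \<and> (\<forall>v<n. \<exists>u\<in>S. d v u \<le> 3 * s vBest 0) \<and>
       s vBMask 0 = of_nat (set_mask S))"

definition beats :: "state \<Rightarrow> rat \<Rightarrow> bool" where
  "beats s r \<longleftrightarrow> s vFound 0 = 1 \<and> s vBest 0 \<le> r"

lemma written_scan[simp]:
  "written (scan m N) = {vY, vV, 1, vMk, vOk, vJ, vSum, vFound, vBest, vBMask}"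
  by (auto simp: scan_def)

lemma wp_scan:
  assumes s: "prepared s" "s vLay 0 = of_nat l" "s vR 0 = r" "table r (pivots r n) l s" "result s"
    and r: "0 \<le> r" "rat_size r \<le> B"
  shows "wp B (scan m N) s
    (\<lambda>s'. result s' \<and> (covers r \<longrightarrow> beats s' r) \<and> (\<forall>r'. beats s r' \<longrightarrow> beats s' r'))"
proof -
  have "\<forall>y. \<exists>S. y < X \<longrightarrow> s aW (l * X + y) = 0 \<or> entry r (pivots r n) l s y S"
    using s(4) by (auto simp: table_def table_sound_def)
  \<comment> \<open>This fixes for the whole scan which set each nonzero cell describes, as the scan
    leaves the table unchanged.\<close>
  then obtain Sol where Sol: "\<And>y. y < X \<Longrightarrow> s aW (l * X + y) = 0 \<or> entry r (pivots r n) l s y (Sol y)"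
    by metis
  define I where "I y t \<longleftrightarrow> result t \<and> (\<forall>r'. beats s r' \<longrightarrow> beats t r') \<and>
    (\<forall>y'<y. 1 \<le> s aW (l * X + y') \<longrightarrow> admissible (Sol y') \<longrightarrow> beats t r)" for y t
  let ?b = "Conj (Conj (Leq (Const 1) (Read aW old_pos))
                    (Leq (Read aW old_pos) (Add (Const 1) (budget_entry m (Const 0)))))
              (Neg (Conj (Leq (Const 1) (Var vFound)) (Leq (Var vBest) (Var vR))))"
  let ?store = "Set vFound (Const 1) ;; Set vBest (Var vR) ;; Set vBMask (Read aM old_pos)"
  let ?c = "Set vMk (Read aM old_pos) ;; check m N ;; Cond (Leq (Const 1) (Var vOk)) ?store Skip"
  show ?thesis unfolding scan_def
  proof (rule wp_For[where I = I and k = X])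
    show "X + 2 \<le> B" using B_X by simp
    show "I 0 (s(vY := (s vY)(0 := x)))" for x using s(5) by (simp add: I_def result_def beats_def)
    have "result (t(vY := (t vY)(0 := x))) = result t" "beats (t(vY := (t vY)(0 := x))) r' = beats t r'"
      for t x r' by (simp_all add: result_def beats_def)
    then show "I i (t(vY := (t vY)(0 := x)))" if "I i t" for i t x
      using that by (simp add: I_def)
    show "aval (Var vX) t = of_nat X"
      if "\<forall>a. a \<notin> insert vY (written (Cond ?b ?c Skip)) \<longrightarrow> t a = s a" for t
      using that s by (simp add: prepared_def)
  next
    fix t assume t: "I X t"
    \<comment> \<open>The feasible choice need not be in the table, but the set stored under its
      code is admissible and hence passes the check, unless a radius at most r was known
      already.\<close>
    have "beats t r" if "covers r"
    proof -
      have "pivots r n \<subseteq> {..<n}" by (rule pivots_less)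
      with \<open>covers r\<close> obtain S where S: "S \<in> choices r (pivots r n)"
        "\<And>T. T \<subseteq> {v. v < n \<and> good v} \<Longrightarrow> (\<Sum>v\<in>T. code v) = (\<Sum>v\<in>S. code v) \<Longrightarrow>
          (\<Sum>v\<in>T. w 0 v) \<le> (\<Sum>v\<in>S. w 0 v) \<Longrightarrow> admissible T"
        by (rule covers_choice) blast
      let ?y = "\<Sum>v\<in>S. code v"
      have y: "?y < X" using choices_subset[OF S(1)] by (intro sum_code_less) auto
      have le: "1 \<le> s aW (l * X + ?y)" "s aW (l * X + ?y) \<le> 1 + (\<Sum>v\<in>S. w 0 v)"
        using s(4) S by (auto simp: table_def table_complete_def)
      then have "entry r (pivots r n) l s ?y (Sol ?y)" using Sol[OF y] by auto
      then have "admissible (Sol ?y)"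
        using le choices_subset by (intro S(2)) (auto simp: entry_def)
      then show ?thesis using t y le unfolding I_def by blast
    qed
    then show "result t \<and> (covers r \<longrightarrow> beats t r) \<and> (\<forall>r'. beats s r' \<longrightarrow> beats t r')"
      using t by (simp add: I_def)
  next
    fix y t assume y: "y < X" and I: "I y t" and tY: "t vY 0 = of_nat y"
      and fr: "\<forall>a. a \<notin> insert vY (written (Cond ?b ?c Skip)) \<longrightarrow> t a = s a"
    have fr': "\<forall>a. a \<notin> {vY, vV, 1, vMk, vOk, vJ, vSum, vFound, vBest, vBMask} \<longrightarrow> t a = s a"
      using fr by simp
    have prep: "prepared t" by (rule prepared_cong[OF s(1) fr']) simp
    have t: "t 0 = A" "t vX 0 = of_nat X" "t vLay 0 = of_nat l" "t vR 0 = r" "t aW = s aW" "t aM = s aM"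
      using fr' s by (simp_all add: prepared_def)
    have old: "aval old_pos t' = of_nat (l * X + y)"
      if "t' vLay = t vLay" "t' vX = t vX" "t' vY = t vY" for t'
      using that t tY by (simp add: old_pos_def)
    have W: "aval (Read aW old_pos) t = s aW (l * X + y)" 
      by (simp only: aval_Read[OF old[OF refl refl refl]] t)
    have M: "aval (Read aM old_pos) t' = s aM (l * X + y)"
      if "t' vLay = t vLay" "t' vX = t vX" "t' vY = t vY" "t' aM = t aM" for t'
      by (simp only: aval_Read[OF old[OF that(1-3)]] t that(4))
    have L0: "aval (budget_entry m (Const 0)) t = L 0" using t m_pos by (intro aval_budget) simp_all
    have bv: "bval ?b t \<longleftrightarrow> (1 \<le> s aW (l * X + y) \<and> s aW (l * X + y) \<le> 1 + L 0) \<and>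
      \<not> (1 \<le> t vFound 0 \<and> t vBest 0 \<le> r)"
      unfolding bval.simps W aval.simps(1,3) L0 using t(4) by simp
    have found: "1 \<le> t vFound 0 \<longleftrightarrow> t vFound 0 = 1" using I by (auto simp: I_def result_def)
    show "wp B (Cond ?b ?c Skip) t (I (Suc y))"
    proof (rule wp_Cond)
      assume b: "bval ?b t"
      then have E: "entry r (pivots r n) l s y (Sol y)" using Sol[OF y] unfolding bv by auto
      have ch: "Sol y \<in> choices r (pivots r n)" using E by (simp add: entry_def)
      have sub: "Sol y \<subseteq> {..<n}" using choices_subset[OF ch] by auto
      have set_mask: "s aM (l * X + y) = of_nat (set_mask (Sol y))" using E by (simp add: entry_def)
      have w0: "(\<Sum>v\<in>Sol y. w 0 v) \<le> L 0" using E b unfolding bv by (simp add: entry_def)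
      have adm: "admissible (Sol y) \<longleftrightarrow> within_limits (Sol y) m"
        using w0 sub by (simp add: admissible_def within_limits_def)
      have nb: "\<not> beats t r" using b found unfolding bv beats_def by simp
      have size: "rat_size (of_nat (set_mask (Sol y))) \<le> B"
        using set_mask_less_n[OF sub] by (intro size_power) simp
      let ?t = "t(vMk := (t vMk)(0 := of_nat (set_mask (Sol y))))"
      have "prepared ?t" by (rule prepared_cong[OF prep, of "{vMk}"]) simp_all
      then have "wp B (check m N) ?t (\<lambda>s'. s' vOk 0 = (if within_limits (Sol y) m then 1 else 0))"
        by (rule wp_check) (use sub in simp_all)
      then have "wp B (check m N ;; Cond (Leq (Const 1) (Var vOk)) ?store Skip) ?t (I (Suc y))"
      proof (rule wp_SeqI)
        fix u assume ufr: "\<forall>a. a \<notin> written (check m N) \<longrightarrow> u a = ?t a"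
          and ok: "u vOk 0 = (if within_limits (Sol y) m then 1 else 0)"
        have u: "u vLay = t vLay" "u vX = t vX" "u vY = t vY" "u aM = t aM" "u vR = t vR"
          "u vFound = t vFound" "u vBest = t vBest" "u vBMask = t vBMask" using ufr by simp_all
        show "wp B (Cond (Leq (Const 1) (Var vOk)) ?store Skip) u (I (Suc y))"
        proof (rule wp_Cond)
          assume "bval (Leq (Const 1) (Var vOk)) u"
          then have "within_limits (Sol y) m" using ok by (simp split: if_splits)
          then have ad: "admissible (Sol y)" using adm by simp
          have cov: "\<forall>v<n. \<exists>u\<in>Sol y. d v u \<le> 3 * r" using choices_cover[OF r(1) ch] by blast
          let ?u = "u(vFound := (u vFound)(0 := 1), vBest := (u vBest)(0 := r))"
          let ?v = "?u(vBMask := (u vBMask)(0 := of_nat (set_mask (Sol y))))"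
          have "result ?v" using ad cov by (auto simp: result_def)
          \<comment> \<open>A result is replaced only if its radius exceeds r, so no earlier
            guarantee is lost.\<close>
          moreover have "beats ?v r' " if "beats s r'" for r'
          proof -
            have "beats t r'" using I that by (simp add: I_def)
            then show ?thesis using nb by (auto simp: beats_def)
          qed
          moreover have "beats ?v r" by (simp add: beats_def)
          ultimately have "I (Suc y) ?v" by (simp add: I_def)
          moreover have "aval (Read aM old_pos) ?u = of_nat (set_mask (Sol y))"
            unfolding set_mask[symmetric] by (rule M) (simp_all add: u)
          ultimately show "wp B ?store u (I (Suc y))"
            using r(2) size u t
            by (intro wp_Assign_Seq[where a = vFound and k = 0 and x = 1]
                wp_Assign_Seq[where a = vBest and k = 0 and x = r]
                wp_Set[where a = vBMask and x = "of_nat (set_mask (Sol y))"]) (simp_all del: aval.simps(2) add: aval_Read[of "Const 0" _ 0])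
        next
          assume "\<not> bval (Leq (Const 1) (Var vOk)) u"
          then have "\<not> admissible (Sol y)" using ok adm by (simp split: if_splits)
          then have "I (Suc y) u" using I u by (auto simp: I_def less_Suc_eq result_def beats_def)
          then show "wp B Skip u (I (Suc y))" by (rule wp_Skip)
        qed
      qed
      then show "wp B ?c t (I (Suc y))"
        using size set_mask by (intro wp_Assign_Seq[where a = vMk and k = 0 and x = "of_nat (set_mask (Sol y))"])
          (simp_all add: M del: aval.simps(2))
    next
      assume nbv: "\<not> bval ?b t"
      have "beats t r" if a: "1 \<le> s aW (l * X + y)" "admissible (Sol y)"
      proof -
        have "entry r (pivots r n) l s y (Sol y)" using Sol[OF y] a by auto
        then have "s aW (l * X + y) \<le> 1 + L 0" using a(2) by (simp add: entry_def admissible_def)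
        then show ?thesis using nbv a found unfolding bv beats_def by blast
      qed
      then have "I (Suc y) t" using I by (auto simp: I_def less_Suc_eq)
      then show "wp B Skip t (I (Suc y))" by (rule wp_Skip)
    qed
  qed simp
qed

section \<open>The loop over all radii\<close>

lemma written_first_layer[simp]: "written first_layer = {vLay, aW, aM}"
  by (auto simp: first_layer_def)

lemma written_try_radius[simp]:
  "written (try_radius m N) = {vR, vLay, aW, aM, vP, vPiv, vU, aPiv, vY, vV, 1, vMk, vOk, vJ, vSum,
     vFound, vBest, vBMask}"
  by (auto simp: try_radius_def)

text \<open>Each radius consumes one initial layer and at most one layer per pivot, hence at most n
  + 1.\<close>

definition round_inv :: "nat \<Rightarrow> state \<Rightarrow> bool" where
  "round_inv q s \<longleftrightarrow> (\<exists>l\<le>q * (n + 1). s vLay 0 = of_nat l \<and> fresh (Suc l) s) \<and> result s \<and>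
     (\<forall>q'<q. covers (A (1 + q')) \<longrightarrow> beats s (A (1 + q')))"

lemma A_dist_nonneg: "q < n * n \<Longrightarrow> 0 \<le> A (1 + q)"
proof -
  assume q: "q < n * n"
  then have n: "0 < n" by (cases n) auto
  have "q div n < n" using q by (simp add: less_mult_imp_div_less)
  moreover have "q mod n < n" using n by simp
  ultimately show ?thesis using A_dist[of "q div n" "q mod n"] d_nonneg by simp
qed

lemma wp_try_radius:
  assumes s: "prepared s" "s vQ 0 = of_nat q" "round_inv q s" and q: "q < n * n"
  shows "wp B (try_radius m N) s (round_inv (Suc q))"
  unfolding try_radius_def
proof (rule wp_Assign_Seq[where k = 0])
  define r where "r = A (1 + q)"
  have sA: "s 0 = A" using s by (simp add: prepared_def)
  have r: "0 \<le> r" "rat_size r \<le> B" using A_dist_nonneg[OF q] B_input by (simp_all add: r_def)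
  obtain l where l: "l \<le> q * (n + 1)" "s vLay 0 = of_nat l" "fresh (Suc l) s"
    using s unfolding round_inv_def by blast
  have "Suc q * (n + 1) \<le> n * n * (n + 1)" using q by (intro mult_le_mono1) simp
  then have lB: "l + n + 5 \<le> B" using l B_n by simp
  show "aval (Entry (Const 0) (Var vQ)) s = r"
    using aval_Entry[of s "Const 0" 0 "Var vQ" q] s sA by (simp add: r_def)
  show "rat_size r \<le> B" by (rule r)
  let ?s = "s(vR := (s vR)(0 := r))"
  have prep: "prepared ?s" by (rule prepared_cong[OF s(1), of "{vR}"]) simp_all
  have "wp B first_layer ?s (pivot_inv r (Suc l) 0)"
    using prep l lB by (intro wp_first_layer) (simp_all add: fresh_def)
  then show "wp B (first_layer ;; For vP (Var 0) pivot_step ;; scan m N) ?s (round_inv (Suc q))"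
  proof (rule wp_SeqI)
    fix t assume t: "\<forall>a. a \<notin> written first_layer \<longrightarrow> t a = ?s a" "pivot_inv r (Suc l) 0 t"
    have "wp B (For vP (Var 0) pivot_step) t (pivot_inv r (Suc l) n)"
    proof (rule wp_For[where I = "pivot_inv r (Suc l)" and k = n])
      show "n + 2 \<le> B" using B_n by simp
      have indep: "pivot_inv r (Suc l) i (t(vP := (t vP)(0 := x)))" if "pivot_inv r (Suc l) i t" for i t x
      proof -
        have "table r P l' (t(vP := (t vP)(0 := x))) = table r P l' t" for P l'
          by (rule table_cong) simp_all
        then show ?thesis using that by (simp add: pivot_inv_def)
      qed
      then show "pivot_inv r (Suc l) 0 (t(vP := (t vP)(0 := x)))" for x using t(2) by blast
      show "pivot_inv r (Suc l) i (t(vP := (t vP)(0 := x)))" if "pivot_inv r (Suc l) i t" for i t x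
        using indep that .
      fix p t' assume t': "\<forall>a. a \<notin> insert vP (written pivot_step) \<longrightarrow> t' a = t a"
      have fr: "\<forall>a. a \<notin> {vP, vPiv, vU, aPiv, vY, vV, aM, aW, vLay} \<longrightarrow> t' a = ?s a"
        using t(1) t' by simp
      have pr: "prepared t'" by (rule prepared_cong[OF prep fr]) simp
      then show "aval (Var 0) t' = of_nat n" using A_0 by (simp add: prepared_def)
      assume "p < n" "pivot_inv r (Suc l) p t'" "t' vP 0 = of_nat p"
      then show "wp B pivot_step t' (pivot_inv r (Suc l) (Suc p))"
        using pr fr lB by (intro wp_pivot_step) simp_all
    qed simp_all
    then show "wp B (For vP (Var 0) pivot_step ;; scan m N) t (round_inv (Suc q))"
    proof (rule wp_SeqI)
      fix u assume u: "\<forall>a. a \<notin> written (For vP (Var 0) pivot_step) \<longrightarrow> u a = t a" "pivot_inv r (Suc l) n u"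
      have fr: "\<forall>a. a \<notin> {vR, vP, vPiv, vU, aPiv, vY, vV, aM, aW, vLay} \<longrightarrow> u a = s a"
        using t(1) u(1) by simp
      have pr: "prepared u" by (rule prepared_cong[OF s(1) fr]) simp
      have uR: "u vR 0 = r" using u(1) t(1) by simp
      have same: "u vFound = s vFound" "u vBest = s vBest" "u vBMask = s vBMask" using fr by simp_all
      then have res: "result u" using s(3) by (simp add: round_inv_def result_def)
      have bt: "beats u r' = beats s r'" for r' using same by (simp add: beats_def)
      obtain l' where l': "l' \<le> Suc l + n" "u vLay 0 = of_nat l'" "table r (pivots r n) l' u"
        using u(2) unfolding pivot_inv_def by blast
      show "wp B (scan m N) u (round_inv (Suc q))"
      proof (rule wp_mono[OF wp_scan[OF pr l'(2) uR l'(3) res r]])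
        fix v assume v: "\<forall>a. a \<notin> written (scan m N) \<longrightarrow> v a = u a"
          and v': "result v \<and> (covers r \<longrightarrow> beats v r) \<and> (\<forall>r'. beats u r' \<longrightarrow> beats v r')"
        have "l' \<le> Suc q * (n + 1)" using l' l by simp
        moreover have "v vLay 0 = of_nat l'" "v aW = u aW" using v l' by simp_all
        moreover from this have "fresh (Suc l') v" using l' by (simp add: table_def fresh_def)
        moreover have "\<forall>q'<Suc q. covers (A (1 + q')) \<longrightarrow> beats v (A (1 + q'))"
          using v' s(3) bt unfolding r_def round_inv_def less_Suc_eq by blast
        ultimately show "round_inv (Suc q) v" using v' unfolding round_inv_def by blast
      qed
    qed
  qed
qed simp

lemma wp_knapsack_center:
  assumes s: "s 0 = A" "\<And>a i. a \<noteq> 0 \<Longrightarrow> s a i = 0"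
  shows "wp B (knapsack_center m N) s (\<lambda>s'. \<exists>S. (\<forall>v<n. s' 1 v = (if v \<in> S then 1 else 0)) \<and>
    (S = {} \<or> admissible S) \<and> S \<subseteq> {..<n} \<and>
    (\<forall>u<n. \<forall>v<n. covers (d u v) \<longrightarrow> admissible S \<and> (\<forall>x<n. \<exists>y\<in>S. d x y \<le> 3 * d u v)))"
    (is "wp B _ _ ?Q")
  unfolding knapsack_center_def
proof (rule wp_SeqI[OF wp_prepare[of s, OF s(1)]])
  fix s1 assume s1: "\<forall>a. a \<notin> written (prepare m N) \<longrightarrow> s1 a = s a" and prep: "prepared s1"
  have fr: "\<forall>a. a \<notin> {vX, vI, aIdx, aPow, vV, aGood, aCode, vJ} \<longrightarrow> s1 a = s a"
    using s1 by (simp add: prepare_def)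
  have "round_inv 0 s1" unfolding round_inv_def
    using fr s(2) by (auto simp: fresh_def result_def)
  have "wp B (For vQ (Mul (Var 0) (Var 0)) (try_radius m N)) s1 (\<lambda>t. prepared t \<and> round_inv (n * n) t)"
  proof (rule wp_For[where I = round_inv and k = "n * n"])
    show "n * n + 2 \<le> B" using B_n by simp
    have indep: "round_inv i (t(vQ := (t vQ)(0 := x)))" if "round_inv i t" for i t x
      using that by (simp add: round_inv_def fresh_def result_def beats_def)
    then show "round_inv 0 (s1(vQ := (s1 vQ)(0 := x)))" for x using \<open>round_inv 0 s1\<close> by blast
    show "round_inv i (t(vQ := (t vQ)(0 := x)))" if "round_inv i t" for i t x using indep that .
    fix q t assume t: "\<forall>a. a \<notin> insert vQ (written (try_radius m N)) \<longrightarrow> t a = s1 a"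
    have pr: "prepared t" by (rule prepared_cong[OF prep t]) simp
    then show "aval (Mul (Var 0) (Var 0)) t = of_nat (n * n)" using A_0 by (simp add: prepared_def)
    show "q < n * n \<Longrightarrow> round_inv q t \<Longrightarrow> t vQ 0 = of_nat q \<Longrightarrow> wp B (try_radius m N) t (round_inv (Suc q))"
      using pr by (intro wp_try_radius)
    show "round_inv (n * n) t \<Longrightarrow> prepared t \<and> round_inv (n * n) t" using pr by simp
  qed simp
  then show "wp B (For vQ (Mul (Var 0) (Var 0)) (try_radius m N) ;; Set vMk (Var vBMask) ;; decode) s1 ?Q"
  proof (rule wp_SeqI)
    fix t assume t: "prepared t \<and> round_inv (n * n) t"
    then have res: "result t" by (simp add: round_inv_def)
    define S where "S = (if t vFound 0 = 1 then (SOME S. admissible S \<and>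
      (\<forall>v<n. \<exists>u\<in>S. d v u \<le> 3 * t vBest 0) \<and> t vBMask 0 = of_nat (set_mask S)) else {})"
    have found: "admissible S \<and> (\<forall>v<n. \<exists>u\<in>S. d v u \<le> 3 * t vBest 0) \<and> t vBMask 0 = of_nat (set_mask S)"
      if "t vFound 0 = 1"
    proof -
      have "\<exists>S. admissible S \<and> (\<forall>v<n. \<exists>u\<in>S. d v u \<le> 3 * t vBest 0) \<and> t vBMask 0 = of_nat (set_mask S)"
        using res that by (auto simp: result_def)
      from someI_ex[OF this] show ?thesis using that by (simp add: S_def)
    qed
    have S: "S = {} \<or> admissible S" using found by (auto simp: S_def)
    then have sub: "S \<subseteq> {..<n}" by (auto simp: admissible_def)
    have mk: "t vBMask 0 = of_nat (set_mask S)"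
    proof (cases "t vFound 0 = 1")
      case False
      then show ?thesis using res by (auto simp: S_def set_mask_def result_def)
    qed (use found in blast)
    have opt: "admissible S \<and> (\<forall>x<n. \<exists>y\<in>S. d x y \<le> 3 * d u v)" if "u < n" "v < n" "covers (d u v)" for u v
    proof -
      \<comment> \<open>The distance of u and v is the radius tried in round u * n + v.\<close>
      have "u * n + v < Suc u * n" using that by simp
      also have "\<dots> \<le> n * n" using that by (intro mult_le_mono1) simp
      finally have "beats t (d u v)"
        using t that A_dist[of u v] unfolding round_inv_def by (metis add.assoc)
      then have b: "t vFound 0 = 1" "t vBest 0 \<le> d u v" by (auto simp: beats_def)
      have "\<exists>y\<in>S. d x y \<le> 3 * d u v" if x: "x < n" for x
      proof -
        obtain y where "y \<in> S" "d x y \<le> 3 * t vBest 0" using found[OF b(1)] x by blast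
        then show ?thesis using b(2) by (intro bexI[of _ y]) auto
      qed
      then show ?thesis using found[OF b(1)] by blast
    qed
    let ?t = "t(vMk := (t vMk)(0 := of_nat (set_mask S)))"
    have "prepared t" using t by simp
    then have "prepared ?t" by (rule prepared_cong[of _ "{vMk}"]) simp_all
    then have "wp B decode ?t (\<lambda>s'. \<forall>v<n. s' 1 v = (if v \<in> S then 1 else 0))"
      by (rule wp_decode) (use sub in simp_all)
    then have "wp B decode ?t ?Q"
      by (rule wp_mono) (use S sub opt in blast)
    moreover have "rat_size (of_nat (set_mask S)) \<le> B"
      using set_mask_less_n[OF sub] by (intro size_power) simp
    ultimately show "wp B (Set vMk (Var vBMask) ;; decode) t ?Q"
      using mk by (intro wp_Assign_Seq[where k = 0 and x = "of_nat (set_mask S)"]) simp_all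
  qed
qed

end

section \<open>The encoding of instances\<close>

lemma length_concat_rows: "length (concat (map (\<lambda>u. map (f u) [0..<n]) [a..<a + k])) = k * n"
  by (induction k) (simp_all add: add.commute)

lemma concat_rows_nth:
  assumes "i < k" "j < n"
  shows "concat (map (\<lambda>u. map (f u) [0..<n]) [a..<a + k]) ! (i * n + j) = f (a + i) j"
  using assms(1)
proof (induction k)
  case (Suc k)
  note len = length_concat_rows[of f n a k]
  show ?case
  proof (cases "i = k")
    case True
    then show ?thesis using len assms(2) by (simp add: nth_append)
  next
    case False
    then have "i < k" using Suc by simp
    have "i * n + j < Suc i * n" using assms(2) by simp
    also have "\<dots> \<le> k * n" using \<open>i < k\<close> by (intro mult_le_mono1) simp
    finally show ?thesis using Suc.IH[OF \<open>i < k\<close>] len by (simp add: nth_append)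
  qed
qed simp

lemma row_index_less: "i < k \<Longrightarrow> j < n \<Longrightarrow> i * n + j < k * (n :: nat)"
proof -
  assume "i < k" "j < n"
  then have "i * n + j < Suc i * n" by simp
  also have "\<dots> \<le> k * n" using \<open>i < k\<close> by (intro mult_le_mono1) simp
  finally show ?thesis .
qed

lemma length_encode: "length (encode m n d w L) = 1 + n * n + m * n + m"
  using length_concat_rows[of d n 0 n] length_concat_rows[of w n 1 m] by (simp add: encode_def)

lemma encode_dist:
  assumes "u < n" "v < n"
  shows "encode m n d w L ! (1 + u * n + v) = d u v"
  using concat_rows_nth[of u n v n d 0] length_concat_rows[of d n 0 n] row_index_less[OF assms] assms
  by (simp add: encode_def nth_append)

lemma encode_weight:
  assumes "j < m" "v < n"
  shows "encode m n d w L ! (1 + (n + j) * n + v) = w (Suc j) v"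
proof -
  have "(n + j) * n + v = n * n + (j * n + v)" by (simp add: algebra_simps)
  then show ?thesis
    using concat_rows_nth[of j m v n w 1] length_concat_rows[of d n 0 n] length_concat_rows[of w n 1 m]
      row_index_less[OF assms] assms
    by (simp add: encode_def nth_append del: upt_Suc)
qed

lemma encode_budget:
  assumes "j < m"
  shows "encode m n d w L ! (1 + (n + m) * n + j) = L (Suc j)"
proof -
  have "(n + m) * n + j = n * n + (m * n + j)" by (simp add: algebra_simps)
  then show ?thesis
    using length_concat_rows[of d n 0 n] length_concat_rows[of w n 1 m] assms
    by (simp add: encode_def nth_append del: upt_Suc)
qed

lemma input_size_nth: "input_size xs = (\<Sum>i<length xs. rat_size (xs ! i))"
  by (simp add: input_size_def sum_list_sum_nth atLeast0LessThan)

lemma length_le_input_size: "length xs \<le> input_size xs"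
proof -
  have "(\<Sum>i<length xs. 1) \<le> (\<Sum>i<length xs. rat_size (xs ! i))"
    using rat_size_pos by (intro sum_mono)
  then show ?thesis by (simp add: input_size_nth)
qed

lemma rat_size_nth_le: "i < length xs \<Longrightarrow> rat_size (xs ! i) \<le> input_size xs"
  unfolding input_size_nth by (rule member_le_sum) auto

text \<open>The summands sit in distinct cells of the input, so their total size is already part of
  the input size.\<close>

lemma sum_rat_size_weights:
  assumes "j < m" "S \<subseteq> {..<n}"
  shows "(\<Sum>v\<in>S. rat_size (w (Suc j) v)) \<le> input_size (encode m n d w L)"
proof -
  let ?xs = "encode m n d w L" and ?g = "\<lambda>v. 1 + (n + j) * n + v"
  have "(\<Sum>v\<in>S. rat_size (w (Suc j) v)) = (\<Sum>v\<in>S. rat_size (?xs ! ?g v))"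
    using assms encode_weight[of j m _ n d w L] by (intro sum.cong) auto
  also have "\<dots> = (\<Sum>i\<in>?g ` S. rat_size (?xs ! i))" by (subst sum.reindex) auto
  also have "\<dots> \<le> input_size ?xs"
    unfolding input_size_nth
  proof (rule sum_mono2)
    show "?g ` S \<subseteq> {..<length ?xs}"
    proof
      fix i assume "i \<in> ?g ` S"
      then obtain v where v: "i = ?g v" "v < n" using assms by auto
      have "i = 1 + n * n + (j * n + v)" using v by (simp add: algebra_simps)
      then show "i \<in> {..<length ?xs}"
        using row_index_less[OF assms(1) v(2)] by (simp add: length_encode)
    qed
  qed auto
  finally show ?thesis .
qed

lemma rat_size_sum: "rat_size (x + (\<Sum>v\<in>S. f v)) \<le> 3 + 2 * rat_size x + 2 * (\<Sum>v\<in>S. rat_size (f v))"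
proof -
  have "log_height (x + (\<Sum>v\<in>S. f v)) \<le> log_height x + (1 + (\<Sum>v\<in>S. log_height (f v)))"
    using log_height_add[of x "\<Sum>v\<in>S. f v"] log_height_sum[of f S] by linarith
  also have "\<dots> \<le> rat_size x + (1 + (\<Sum>v\<in>S. rat_size (f v)))"
    by (intro add_mono sum_mono log_height_le_rat_size) simp
  finally show ?thesis using rat_size_le_log_height[of "x + (\<Sum>v\<in>S. f v)"] by linarith
qed

text \<open>The three summands majorise the table width \<open>base ^ m\<close>, the number of
  layers n * n * (n + 1), and the linear quantities m, n, \<open>K\<close> and the sizes of inputs
  and weight sums. Only the first has a degree depending on m.\<close>

definition size_poly :: "nat \<Rightarrow> nat \<Rightarrow> nat poly" where
  "size_poly m N = [:1, 0, N:] ^ m + [:0, 0, 1, 1:] + [:m + 20, N + 5:]"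

text \<open>Constraints are shifted from 1..m to 0..m-1, so the constraint kept exactly is number 1
  of the instance.\<close>

lemma knapsack_run_encode:
  fixes L :: "nat \<Rightarrow> rat"
  assumes inst: "knapsack_instance m n d w" and m: "1 \<le> m" and N: "0 < N"
  defines "xs \<equiv> encode m n d w L"
  shows "knapsack_run m n N d (\<lambda>j. w (Suc j)) (\<lambda>j. L (Suc j)) (init_state xs 0)
    (poly (size_poly m N) (input_size xs))"
proof -
  define \<sigma> where "\<sigma> = input_size xs"
  define B where "B = poly (size_poly m N) \<sigma>"
  interpret Metric_space "{..<n}" "\<lambda>u v. real_of_rat (d u v)"
    using inst by (simp add: knapsack_instance_def)
  interpret knapsack_data m n N d "\<lambda>j. w (Suc j)" "\<lambda>j. L (Suc j)"
  proof
    show "0 \<le> d u v" for u v using nonneg[of u v] by simp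
    show "d v v = 0" if "v < n" for v using zero[of v v] that by (metis lessThan_iff of_rat_eq_0_iff)
    show "d u v = d v u" for u v using commute[of u v] by simp
    show "d u x \<le> d u v + d v x" if "u < n" "v < n" "x < n" for u v x
      using triangle[of u v x] that by (simp flip: of_rat_add add: of_rat_less_eq)
    show "0 \<le> w (Suc j) v" if "j < m" "v < n" for j v
      using inst that by (simp add: knapsack_instance_def)
  qed (use m N in auto)
  have len: "length xs = 1 + n * n + m * n + m" by (simp add: xs_def length_encode)
  \<comment> \<open>The numeral n contributes only about log n to the input size; n is bounded
    through the number of input cells instead.\<close>
  have "n \<le> m * n" using m by simp
  then have n: "n \<le> \<sigma>" using length_le_input_size[of xs] len unfolding \<sigma>_def by linarith
  have B: "B = (N * \<sigma> * \<sigma> + 1) ^ m + \<sigma> * \<sigma> * (\<sigma> + 1) + m + N * \<sigma> + 5 * \<sigma> + 20"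
    unfolding B_def size_poly_def by (simp add: algebra_simps)
  have "base \<le> N * \<sigma> * \<sigma> + 1"
    using n unfolding base_def K_def by (simp add: mult_le_mono mult.commute mult.left_commute)
  then have base: "base ^ m \<le> (N * \<sigma> * \<sigma> + 1) ^ m" by (rule power_mono) simp
  have K: "K \<le> N * \<sigma>" using n by (simp add: K_def)
  have cube: "n * n * (n + 1) \<le> \<sigma> * \<sigma> * (\<sigma> + 1)" using n by (intro mult_le_mono) auto
  have size0: "rat_size 0 = 2" "rat_size 1 \<le> 3"
    using rat_size_of_nat[of 0] rat_size_of_nat_le[of 1] by (simp_all add: floorlog_def)
  have sums: "(\<Sum>v\<in>S. rat_size (w (Suc j) v)) \<le> \<sigma>" if "j < m" "S \<subseteq> {..<n}" for j S
    unfolding \<sigma>_def xs_def using that by (rule sum_rat_size_weights)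
  have read: "init_state xs 0 i = xs ! i" if "i < length xs" for i
    using that by (simp add: init_state_def)
  have "knapsack_run m n N d (\<lambda>j. w (Suc j)) (\<lambda>j. L (Suc j)) (init_state xs 0) B"
  proof
    show "init_state xs 0 0 = of_nat n" using read[of 0] len by (simp add: xs_def encode_def)
    show "init_state xs 0 (1 + u * n + v) = d u v" if "u < n" "v < n" for u v
      using row_index_less[OF that] read[of "1 + u * n + v"] len encode_dist[OF that]
      by (simp add: xs_def)
    show "init_state xs 0 (1 + (n + j) * n + v) = w (Suc j) v" if "j < m" "v < n" for j v
    proof -
      have "1 + (n + j) * n + v < length xs"
        using row_index_less[OF that] unfolding len by (simp add: algebra_simps)
      then show ?thesis using read encode_weight[OF that] by (simp add: xs_def)
    qed
    show "init_state xs 0 (1 + (n + m) * n + j) = L (Suc j)" if "j < m" for j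
    proof -
      have "1 + (n + m) * n + j < length xs" using that unfolding len by (simp add: algebra_simps)
      then show ?thesis using read encode_budget[OF that] by (simp add: xs_def)
    qed
    show "base ^ m + 4 \<le> B" "n * n * (n + 1) + n + 4 \<le> B" "m + 4 \<le> B" "K + 4 \<le> B"
      unfolding B using base K cube n by linarith+
    show "rat_size (init_state xs 0 i) \<le> B" for i
    proof (cases "i < length xs")
      case True
      then have "rat_size (init_state xs 0 i) \<le> \<sigma>" using read rat_size_nth_le by (simp add: \<sigma>_def)
      then show ?thesis unfolding B by linarith
    next
      case False
      then show ?thesis unfolding B using size0 by (simp add: init_state_def)
    qed
    show "rat_size (\<Sum>v\<in>S. w (Suc j) v) \<le> B" if "j < m" "S \<subseteq> {..<n}" for j S
      using rat_size_sum[of 0 "w (Suc j)" S] sums[OF that] size0 unfolding B by simp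
    show "rat_size (1 + (\<Sum>v\<in>S. w (Suc 0) v)) \<le> B" if "S \<subseteq> {..<n}" for S
      using rat_size_sum[of 1 "w (Suc 0)" S] sums[of 0 S] that m size0 unfolding B by simp
  qed
  then show ?thesis by (simp add: B_def \<sigma>_def)
qed

text \<open>No feasible set is assumed, because the time bound concerns all instances; hence the
  alternative of an empty result.\<close>

lemma knapsack_center_exec:
  fixes L :: "nat \<Rightarrow> rat"
  assumes inst: "knapsack_instance m n d w" and m: "1 \<le> m" and N: "0 < N"
  defines "xs \<equiv> encode m n d w L" and "B \<equiv> poly (size_poly m N) (input_size (encode m n d w L))"
  obtains t s where "exec (knapsack_center m N) (init_state xs) t s" "t \<le> time_bound B (knapsack_center m N)"
    "returned_set n s = {} \<or> knapsack_data.admissible m n N (\<lambda>j. w (Suc j)) (\<lambda>j. L (Suc j)) (returned_set n s)"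
    "\<And>u v. u < n \<Longrightarrow> v < n \<Longrightarrow> knapsack_data.covers m n d (\<lambda>j. w (Suc j)) (\<lambda>j. L (Suc j)) (d u v) \<Longrightarrow>
       (\<forall>x<n. \<exists>y\<in>returned_set n s. d x y \<le> 3 * d u v)"
proof -
  interpret knapsack_run m n N d "\<lambda>j. w (Suc j)" "\<lambda>j. L (Suc j)" "init_state xs 0" B
    unfolding xs_def B_def using inst m N by (rule knapsack_run_encode)
  have "bounded_state B (init_state xs)"
    unfolding bounded_state_def
  proof (intro conjI allI)
    show "rat_size (init_state xs a i) \<le> B" for a i
    proof (cases "a = 0")
      case True
      then show ?thesis using B_input[of i] by simp
    qed (simp add: init_state_def)
  qed (use B_m in simp)
  then obtain t s where ex: "exec (knapsack_center m N) (init_state xs) t s"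
    "t \<le> time_bound B (knapsack_center m N)"
    and "\<exists>S. (\<forall>v<n. s 1 v = (if v \<in> S then 1 else 0)) \<and> (S = {} \<or> admissible S) \<and> S \<subseteq> {..<n} \<and>
      (\<forall>u<n. \<forall>v<n. covers (d u v) \<longrightarrow> admissible S \<and> (\<forall>x<n. \<exists>y\<in>S. d x y \<le> 3 * d u v))"
    using wp_knapsack_center[of "init_state xs"] unfolding wp_def by (auto simp: init_state_def)
  then obtain S where S: "\<forall>v<n. s 1 v = (if v \<in> S then 1 else 0)" "S = {} \<or> admissible S" "S \<subseteq> {..<n}"
    "\<And>u v. u < n \<Longrightarrow> v < n \<Longrightarrow> covers (d u v) \<Longrightarrow> \<forall>x<n. \<exists>y\<in>S. d x y \<le> 3 * d u v"
    by blast
  have "returned_set n s = S" using S(1,3) by (auto simp: returned_set_def split: if_splits)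
  then show thesis using that[OF ex] S by simp
qed

section \<open>Radius, optimum and approximation guarantee\<close>

lemma INF_finite_attained:
  fixes f :: "'a \<Rightarrow> ennreal"
  assumes "finite S" "S \<noteq> {}"
  obtains u where "u \<in> S" "(INF x\<in>S. f x) = f u"
proof -
  have "Inf (f ` S) \<in> f ` S" using assms Min_in[of "f ` S"] cInf_eq_Min[of "f ` S"] by simp
  then show thesis using that by blast
qed

lemma SUP_finite_attained:
  fixes f :: "'a \<Rightarrow> ennreal"
  assumes "finite S" "S \<noteq> {}"
  obtains u where "u \<in> S" "(SUP x\<in>S. f x) = f u"
proof -
  have "Sup (f ` S) \<in> f ` S" using assms Max_in[of "f ` S"] cSup_eq_Max[of "f ` S"] by simp
  then show thesis using that by blast
qed

text \<open>A finite radius is an entry of the distance matrix, hence one of the radii tried by the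
  program.\<close>

lemma radius_attained:
  assumes "\<And>u v. 0 \<le> d u v" "F \<subseteq> {..<n}" "F \<noteq> {}"
  obtains u v where "u < n" "v < n" "radius n d F = ennreal (real_of_rat (d u v))"
    "\<And>x. x < n \<Longrightarrow> \<exists>y\<in>F. d x y \<le> d u v"
proof -
  let ?f = "\<lambda>v. INF u\<in>F. ennreal (real_of_rat (d v u))"
  have fin: "finite F" using assms finite_subset by blast
  have "{..<n} \<noteq> {}" using assms by auto
  then obtain u where u: "u < n" "radius n d F = ?f u"
    unfolding radius_def using SUP_finite_attained[of "{..<n}" ?f] by auto
  obtain v where v: "v \<in> F" "?f u = ennreal (real_of_rat (d u v))"
    using INF_finite_attained[OF fin assms(3), of "\<lambda>v. ennreal (real_of_rat (d u v))"] by blast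
  have "\<exists>y\<in>F. d x y \<le> d u v" if "x < n" for x
  proof -
    obtain y where y: "y \<in> F" "?f x = ennreal (real_of_rat (d x y))"
      using INF_finite_attained[OF fin assms(3), of "\<lambda>v. ennreal (real_of_rat (d x v))"] by blast
    have "?f x \<le> radius n d F" unfolding radius_def using that by (intro SUP_upper) simp
    then have "real_of_rat (d x y) \<le> real_of_rat (d u v)"
      using u v y assms(1) by simp
    then show ?thesis using y by (auto simp: of_rat_less_eq)
  qed
  then show thesis using that u v assms(2) by auto
qed

lemma radius_le:
  assumes "\<And>x. x < n \<Longrightarrow> \<exists>y\<in>S. d x y \<le> r"
  shows "radius n d S \<le> ennreal (real_of_rat r)"
  unfolding radius_def
proof (rule SUP_least)
  fix x assume "x \<in> {..<n}"
  then obtain y where "y \<in> S" "d x y \<le> r" using assms by auto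
  then show "(INF u\<in>S. ennreal (real_of_rat (d x u))) \<le> ennreal (real_of_rat r)"
    by (intro INF_lower2[of y] ennreal_leI) (simp_all add: of_rat_less_eq)
qed

theorem theorem5:
  fixes m :: nat and \<epsilon> :: real
  assumes "m \<ge> 1" and "\<epsilon> > 0"
  shows "\<exists>c :: com.
    polynomial_time_on c {encode m n d w L | n d w L. knapsack_instance m n d w} \<and>
    (\<forall>n d w L t s.
       knapsack_instance m n d w \<longrightarrow> (\<exists>S. feasible m n w L S) \<longrightarrow>
       exec c (init_state (encode m n d w L)) t s \<longrightarrow>
       (let S = returned_set n s in
          S \<subseteq> {..<n} \<and>
          radius n d S \<le> 3 * OPT m n d w L \<and>
          (\<exists>i\<in>{1..m}. (\<Sum>v\<in>S. w i v) \<le> L i \<and>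
             (\<forall>j\<in>{1..m} - {i}.
                real_of_rat (\<Sum>v\<in>S. w j v) \<le> (1 + \<epsilon>) * real_of_rat (L j)))))"
proof -
  \<comment> \<open>N depends on \<epsilon> alone, so one program serves all instances.\<close>
  obtain N :: nat where N: "0 < N" "1 / real N < \<epsilon>"
    using assms(2) by (metis nat_approx_posE zero_less_Suc)
  let ?c = "knapsack_center m N"
  show ?thesis
  proof (intro exI[of _ ?c] conjI allI impI)
    obtain p where p: "\<And>B. time_bound B ?c = poly p B" using time_bound_poly by blast
    show "polynomial_time_on ?c {encode m n d w L | n d w L. knapsack_instance m n d w}"
      unfolding polynomial_time_on_def
    proof (intro exI[of _ "pcompose p (size_poly m N)"] ballI)
      fix xs assume "xs \<in> {encode m n d w L | n d w L. knapsack_instance m n d w}"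
      then obtain n d w L where xs: "xs = encode m n d w L" "knapsack_instance m n d w" by blast
      obtain t s where "exec ?c (init_state xs) t s"
        "t \<le> time_bound (poly (size_poly m N) (input_size xs)) ?c"
        unfolding xs(1) by (rule knapsack_center_exec[OF xs(2) assms(1) N(1)])
      then show "\<exists>t s. exec ?c (init_state xs) t s \<and>
        t \<le> poly (pcompose p (size_poly m N)) (input_size xs)"
        by (auto simp: p poly_pcompose)
    qed
  next
    fix n d w L t s
    assume inst: "knapsack_instance m n d w" and feas: "\<exists>S. feasible m n w L S"
      and run: "exec ?c (init_state (encode m n d w L)) t s"
    define S where "S = returned_set n s"
    interpret knapsack_data m n N d "\<lambda>j. w (Suc j)" "\<lambda>j. L (Suc j)"
      using knapsack_run_encode[OF inst assms(1) N(1), of L] by (simp add: knapsack_run_def)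
    interpret Metric_space "{..<n}" "\<lambda>u v. real_of_rat (d u v)"
      using inst by (simp add: knapsack_instance_def)
    obtain t' s' where "exec ?c (init_state (encode m n d w L)) t' s'"
      and "returned_set n s' = {} \<or> admissible (returned_set n s')"
      and "\<And>u v. u < n \<Longrightarrow> v < n \<Longrightarrow> covers (d u v) \<Longrightarrow> \<forall>x<n. \<exists>y\<in>returned_set n s'. d x y \<le> 3 * d u v"
      by (rule knapsack_center_exec[OF inst assms(1) N(1), of L]) blast
    \<comment> \<open>The claim concerns an arbitrary run; determinism identifies it with the
      constructed one.\<close>
    moreover from this have "s' = s" using run exec_deterministic by blast
    ultimately have adm: "S = {} \<or> admissible S"
      and cov: "\<And>u v. u < n \<Longrightarrow> v < n \<Longrightarrow> covers (d u v) \<Longrightarrow> \<forall>x<n. \<exists>y\<in>S. d x y \<le> 3 * d u v"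
      by (simp_all add: S_def)
    \<comment> \<open>Existence of a feasible set makes the budgets nonnegative. Then an empty
      result respects them, and 1 / N may be enlarged to \<epsilon>.\<close>
    have L_nonneg: "0 \<le> L i" if i: "i \<in> {1..m}" for i
    proof -
      obtain F where F: "F \<subseteq> {..<n}" "(\<Sum>v\<in>F. w i v) \<le> L i" using feas i by (auto simp: feasible_def)
      have "0 \<le> (\<Sum>v\<in>F. w i v)" using F i inst by (intro sum_nonneg) (auto simp: knapsack_instance_def)
      then show ?thesis using F by linarith
    qed
    have one: "1 \<in> {1..m}" using assms(1) by simp
    have first: "(\<Sum>v\<in>S. w 1 v) \<le> L 1" using adm L_nonneg[OF one] by (auto simp: admissible_def)
    have other: "real_of_rat (\<Sum>v\<in>S. w j v) \<le> (1 + \<epsilon>) * real_of_rat (L j)" if j: "j \<in> {1..m}" for j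
    proof -
      have "(\<Sum>v\<in>S. w j v) \<le> (1 + 1 / of_nat N) * L j"
      proof (cases "S = {}")
        case True
        then show ?thesis using L_nonneg[OF j] by simp
      next
        case False
        then have "\<forall>i<m. (\<Sum>v\<in>S. w (Suc i) v) \<le> (1 + 1 / of_nat N) * L (Suc i)"
          using adm by (simp add: admissible_def)
        moreover have "j - 1 < m" "Suc (j - 1) = j" using j by auto
        ultimately show ?thesis by metis
      qed
      then have "real_of_rat (\<Sum>v\<in>S. w j v) \<le> real_of_rat ((1 + 1 / of_nat N) * L j)"
        by (simp only: of_rat_less_eq)
      also have "\<dots> = (1 + 1 / real N) * real_of_rat (L j)"
        by (simp add: of_rat_mult of_rat_add of_rat_divide)
      also have "\<dots> \<le> (1 + \<epsilon>) * real_of_rat (L j)"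
        using N(2) L_nonneg[OF j] by (intro mult_right_mono) auto
      finally show ?thesis .
    qed
    have "radius n d S \<le> 3 * radius n d F" if F: "feasible m n w L F" for F
    \<comment> \<open>In the degenerate cases the radius is no matrix entry: without points both
      radii are 0, and an empty F with points present has infinite radius.\<close>
    proof (cases "n = 0 \<or> F = {}")
      case True
      then show ?thesis
      proof
        assume "F = {}"
        show ?thesis
        proof (cases "n = 0")
          case False
          then have "radius n d F = top" using \<open>F = {}\<close> by (auto simp: radius_def)
          then show ?thesis by (simp add: ennreal_mult_top)
        qed (simp add: radius_def)
      qed (simp add: radius_def)
    next
      case False
      have dn: "0 \<le> d u v" for u v using nonneg[of u v] by simp
      obtain u v where uv: "u < n" "v < n" "radius n d F = ennreal (real_of_rat (d u v))"
        "\<And>x. x < n \<Longrightarrow> \<exists>y\<in>F. d x y \<le> d u v"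
        using radius_attained[of d F n] dn F False by (auto simp: feasible_def)
      have "covers (d u v)"
        unfolding covers_def using F uv(4) by (intro exI[of _ F]) (auto simp: feasible_def)
      then have "radius n d S \<le> ennreal (real_of_rat (3 * d u v))"
        using cov[OF uv(1,2)] by (intro radius_le) blast
      also have "\<dots> = 3 * radius n d F"
        using dn[of u v] uv(3) by (simp add: of_rat_mult ennreal_mult)
      finally show ?thesis .
    qed
    moreover obtain F where "feasible m n w L F" "OPT m n d w L = radius n d F"
    proof -
      have "finite {S. feasible m n w L S}"
        by (rule finite_subset[of _ "Pow {..<n}"]) (auto simp: feasible_def)
      then show thesis
        using INF_finite_attained[of "{S. feasible m n w L S}" "radius n d"] feas that
        by (auto simp: OPT_def)
    qed
    ultimately have "radius n d S \<le> 3 * OPT m n d w L" by simp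
    moreover have "S \<subseteq> {..<n}" by (auto simp: S_def returned_set_def)
    ultimately show "let S = returned_set n s in
          S \<subseteq> {..<n} \<and>
          radius n d S \<le> 3 * OPT m n d w L \<and>
          (\<exists>i\<in>{1..m}. (\<Sum>v\<in>S. w i v) \<le> L i \<and>
             (\<forall>j\<in>{1..m} - {i}.
                real_of_rat (\<Sum>v\<in>S. w j v) \<le> (1 + \<epsilon>) * real_of_rat (L j)))"
      unfolding Let_def S_def[symmetric] using first other one by blast
  qed
qed

end
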